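(* Let $R$ be a finite local commutative ring other than a field and $K$ a pure subgroup of $R^\times$. Then the scheme $\mathrm{Cyc}(K,R)$ is normal whenever $K\le\mathcal T\mathcal U_0$.
   Context: All rings have an identity. For a finite local commutative ring $R$ with maximal ideal $\mathrm{rad}(R)$ and residue field of order $q$: $\mathcal T$ is the (cyclic) subgroup of $R^\times$ of order $q-1$ (Teichmüller group), $I_0=\{x\in\mathrm{rad}(R): x\,\mathrm{rad}(R)=\{0\}\}$, $\mathcal U_0=1+I_0$. $K$ is pure if the only ideal $I$ with $1+I\subseteq K$ is $\{0\}$. $\mathrm{Cyc}(K,R)$ is the pair $(R,\mathrm{Rel}(K,R))$ with $\mathrm{Rel}(K,R)$ the relations $\{(x,y): y-x\in rK\}$, $r\in R$; its automorphism group consists of the permutations of $R$ fixing each such relation; it is normal if this group is contained in $\mathrm{A\Gamma L}_1(R)$, the group of permutations $x\mapsto ax^\sigma+b$, $a\in R^\times$, $b\in R$, $\sigma\in\mathrm{Aut}(R)$. *)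

theory Defs
  imports Main
begin

text \<open>The finite commutative ring R is the whole type 'a (class comm_ring_1, with
  finite UNIV). All notions below are relative to that ambient ring.\<close>

definition ring_units :: "'a::comm_ring_1 set" where
  "ring_units = {x. \<exists>y. x * y = 1}"

definition is_ideal :: "'a::comm_ring_1 set \<Rightarrow> bool" where
  "is_ideal I \<longleftrightarrow> 0 \<in> I \<and> (\<forall>x\<in>I. \<forall>y\<in>I. x + y \<in> I) \<and> (\<forall>r. \<forall>x\<in>I. r * x \<in> I)"

definition maximal_ideal :: "'a::comm_ring_1 set \<Rightarrow> bool" where
  "maximal_ideal M \<longleftrightarrow> is_ideal M \<and> M \<noteq> UNIV \<and>
     (\<forall>J. is_ideal J \<and> M \<subseteq> J \<and> J \<noteq> UNIV \<longrightarrow> J = M)"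

definition local_ring :: "'a::comm_ring_1 itself \<Rightarrow> bool" where
  "local_ring _ \<longleftrightarrow> (\<exists>!M::'a set. maximal_ideal M)"

definition rad :: "'a::comm_ring_1 set" where
  "rad = (THE M. maximal_ideal M)"

definition residue_order :: "'a::comm_ring_1 itself \<Rightarrow> nat" where
  "residue_order _ = card (UNIV :: 'a set) div card (rad :: 'a set)"

definition is_unit_subgroup :: "'a::comm_ring_1 set \<Rightarrow> bool" where
  "is_unit_subgroup K \<longleftrightarrow> K \<subseteq> ring_units \<and> 1 \<in> K \<and>
     (\<forall>x\<in>K. \<forall>y\<in>K. x * y \<in> K) \<and> (\<forall>x\<in>K. \<exists>y\<in>K. x * y = 1)"

definition teich :: "'a::comm_ring_1 set" where
  "teich = (THE T. is_unit_subgroup T \<and> card T = residue_order TYPE('a) - 1)"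

definition I0 :: "'a::comm_ring_1 set" where
  "I0 = {x \<in> rad. \<forall>y\<in>rad. x * y = 0}"

definition U0 :: "'a::comm_ring_1 set" where
  "U0 = (\<lambda>x. 1 + x) ` I0"

definition pure :: "'a::comm_ring_1 set \<Rightarrow> bool" where
  "pure K \<longleftrightarrow> (\<forall>I. is_ideal I \<and> (\<lambda>x. 1 + x) ` I \<subseteq> K \<longrightarrow> I = {0})"

definition cyc_rel :: "'a::comm_ring_1 set \<Rightarrow> 'a \<Rightarrow> ('a \<times> 'a) set" where
  "cyc_rel K r = {(x, y). y - x \<in> (\<lambda>k. r * k) ` K}"

definition cyc_aut :: "'a::comm_ring_1 set \<Rightarrow> ('a \<Rightarrow> 'a) set" where
  "cyc_aut K = {f. bij f \<and> (\<forall>r x y. (x, y) \<in> cyc_rel K r \<longleftrightarrow> (f x, f y) \<in> cyc_rel K r)}"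

definition ring_aut :: "('a::comm_ring_1 \<Rightarrow> 'a) set" where
  "ring_aut = {s. bij s \<and> (\<forall>x y. s (x + y) = s x + s y) \<and> (\<forall>x y. s (x * y) = s x * s y) \<and> s 1 = 1}"

definition AGammaL1 :: "('a::comm_ring_1 \<Rightarrow> 'a) set" where
  "AGammaL1 = {f. \<exists>a\<in>ring_units. \<exists>b. \<exists>s\<in>ring_aut. \<forall>x. f x = a * s x + b}"

definition cyc_normal :: "'a::comm_ring_1 set \<Rightarrow> bool" where
  "cyc_normal K \<longleftrightarrow> cyc_aut K \<subseteq> AGammaL1"

end

theory Submission
  imports Defs "HOL-Computational_Algebra.Primes" "HOL-Algebra.Multiplicative_Group" "HOL-Algebra.QuotRing"
begin

text \<open>Write \<open>J\<close> for the radical, \<open>F = R/J\<close>, \<open>V = I0\<close> and \<open>A = {a \<in> V. 1 + a \<in> K}\<close>. The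
  hypotheses on \<open>K\<close> say that \<open>K \<inter> (1 + J) = 1 + A\<close> and that the additive group \<open>A\<close> contains no
  nonzero \<open>F\<close>-subspace of \<open>V\<close>. The proof rests on a rigidity statement: a map \<open>h\<close> with \<open>h 0 = 0\<close> and
  \<open>h x - h y \<in> (x - y) A\<close> for all \<open>x\<close>, \<open>y\<close> is \<open>x \<mapsto> x * h 1\<close>. An automorphism normalised by
  \<open>f 0 = 0\<close>, \<open>f 1 = 1\<close> satisfies \<open>f x - f y \<in> (x - y) K\<close>, so as soon as two such differences agree modulo
  \<open>J\<close>, they agree up to \<open>A\<close>. Rigidity, applied to the defects \<open>f (x + w) - f x - f w\<close> with \<open>w \<in> J\<close>, then
  \<open>f (x + d) - f x - f d\<close>, then \<open>f (x * d) - f x * f d\<close> as maps of \<open>f x\<close> or \<open>f d\<close>, makes them vanish one after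
  the other. Multiplicativity modulo \<open>J\<close>, needed for the last of them, follows as in Hua's theorem, since
  both \<open>f\<close> and \<open>x \<mapsto> 1 / f (1 / x)\<close> are additive modulo \<open>J\<close>.\<close>

section \<open>Finite local rings\<close>

text \<open>\<open>J\<close> stands for the set of nonunits, so its closure under addition is
  exactly locality; \<open>p\<close> is the residue characteristic. An arbitrary \<open>J\<close>
  keeps the definite description in \<open>rad\<close> out of the argument.\<close>

locale finite_local =
  fixes J :: "'a::comm_ring_1 set" and p :: nat
  assumes finite_ring: "finite (UNIV :: 'a set)"
    and J_iff: "x \<in> J \<longleftrightarrow> x \<notin> ring_units"
    and J_add: "x \<in> J \<Longrightarrow> y \<in> J \<Longrightarrow> x + y \<in> J"
    and prime_p: "prime p"
    and p_in_J: "of_nat p \<in> J"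
begin

definition V :: "'a set" where
  "V = {x \<in> J. \<forall>y\<in>J. x * y = 0}"

lemma finite_in_ring: "finite (S :: 'a set)"
  by (rule finite_subset [OF subset_UNIV finite_ring])

section \<open>Units and congruences modulo \<open>J\<close>\<close>

lemma unitI: "x * y = 1 \<Longrightarrow> x \<notin> J"
  by (auto simp: J_iff ring_units_def)

lemma unitE:
  assumes "x \<notin> J"
  obtains y where "x * y = 1" "y \<notin> J"
proof -
  obtain y where y: "x * y = 1" using assms by (auto simp: J_iff ring_units_def)
  then have "y * x = 1" by (simp add: mult.commute)
  then show ?thesis using that y unitI by blast
qed

lemma one_notin_J: "1 \<notin> J"
  by (rule unitI [of _ 1]) simp

text \<open>A factor of a unit is a unit, so the nonunits absorb multiplication.\<close>

lemma J_mult: "x \<in> J \<Longrightarrow> r * x \<in> J"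
  by (metis unitE unitI mult.assoc mult.commute)

lemma J_mult': "x \<in> J \<Longrightarrow> x * r \<in> J"
  by (simp add: J_mult mult.commute)

lemma zero_in_J: "0 \<in> J"
  by (metis mult_zero_left unitE zero_neq_one)

lemma J_neg: "x \<in> J \<Longrightarrow> - x \<in> J"
  using J_mult [of x "-1"] by simp

lemma J_diff: "x \<in> J \<Longrightarrow> y \<in> J \<Longrightarrow> x - y \<in> J"
  using J_add [OF _ J_neg] by fastforce

lemma J_neg_iff: "- x \<in> J \<longleftrightarrow> x \<in> J"
  using J_neg by force

lemma J_diff_commute: "x - y \<in> J \<longleftrightarrow> y - x \<in> J"
  using J_neg_iff [of "x - y"] by simp

lemma J_sum: "(\<And>i. i \<in> S \<Longrightarrow> f i \<in> J) \<Longrightarrow> sum f S \<in> J"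
  by (induction S rule: infinite_finite_induct) (auto simp: zero_in_J J_add)

lemma J_mult_iff: "x * y \<in> J \<longleftrightarrow> x \<in> J \<or> y \<in> J"
proof
  assume xy: "x * y \<in> J"
  show "x \<in> J \<or> y \<in> J"
  proof (rule ccontr)
    assume "\<not> (x \<in> J \<or> y \<in> J)"
    then obtain x' y' where "x * x' = 1" "y * y' = 1" by (metis unitE)
    moreover have "(x * y) * (x' * y') = (x * x') * (y * y')" by (simp only: ac_simps)
    ultimately have "(x * y) * (x' * y') = 1" by simp
    then show False using xy unitI by blast
  qed
qed (auto intro: J_mult J_mult')

lemma J_power_iff: "0 < n \<Longrightarrow> x ^ n \<in> J \<longleftrightarrow> x \<in> J"
proof (induction n)
  case (Suc n)
  then show ?case using one_notin_J by (cases "n = 0") (auto simp: J_mult_iff)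
qed simp

lemma J_cong: "x - y \<in> J \<Longrightarrow> x \<in> J \<longleftrightarrow> y \<in> J"
  using J_add [of "x - y" y] J_diff [of x "x - y"] by auto

lemma J_mult_cong: "x - x' \<in> J \<Longrightarrow> y - y' \<in> J \<Longrightarrow> x * y - x' * y' \<in> J"
proof -
  assume "x - x' \<in> J" "y - y' \<in> J"
  then have "(x - x') * y + x' * (y - y') \<in> J" by (intro J_add J_mult J_mult')
  then show ?thesis by (simp add: algebra_simps)
qed

lemma J_cancel: "u \<notin> J \<Longrightarrow> u * x - u * y \<in> J \<Longrightarrow> x - y \<in> J"
  using J_mult_iff [of u "x - y"] by (simp add: right_diff_distrib)

lemma unit_cancel: "d \<notin> J \<Longrightarrow> d * x = d * y \<Longrightarrow> x = y"
  by (metis unitE mult.assoc mult.commute mult_1_left)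

lemma V_subset_J: "x \<in> V \<Longrightarrow> x \<in> J"
  by (simp add: V_def)

lemma V_kill: "x \<in> V \<Longrightarrow> y \<in> J \<Longrightarrow> x * y = 0" "x \<in> V \<Longrightarrow> y \<in> J \<Longrightarrow> y * x = 0"
  by (auto simp: V_def mult.commute)

lemma V_mult: "x \<in> V \<Longrightarrow> r * x \<in> V"
  by (auto simp: V_def mult.assoc J_mult)

lemma V_add: "x \<in> V \<Longrightarrow> y \<in> V \<Longrightarrow> x + y \<in> V"
  by (auto simp: V_def distrib_right J_add)

text \<open>This makes \<open>V\<close> a vector space over \<open>F\<close>: scalars matter only
  modulo \<open>J\<close>.\<close>

lemma V_cong: "x \<in> V \<Longrightarrow> r - s \<in> J \<Longrightarrow> r * x = s * x"
  using V_kill(2) [of x "r - s"] by (simp add: left_diff_distrib)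

lemma V_of_nat_p: "x \<in> V \<Longrightarrow> of_nat p * x = 0"
  by (simp add: V_kill p_in_J)

text \<open>By Bezout \<open>n\<close> is invertible modulo \<open>p\<close>, and \<open>p\<close>
  kills \<open>V\<close>.\<close>

lemma V_of_nat_cancel:
  assumes "x \<in> V" "\<not> p dvd n" "of_nat n * x = 0"
  shows "x = 0"
proof -
  have "coprime (int n) (int p)"
    using assms(2) prime_p prime_imp_coprime [of p n] by (simp add: coprime_commute)
  then obtain a b where ab: "a * int n + b * int p = 1"
    using bezout_int [of "int n" "int p"] by auto
  have "x = of_int (a * int n + b * int p) * x" by (simp add: ab)
  also have "\<dots> = of_int a * (of_nat n * x) + of_int b * (of_nat p * x)" by (simp add: algebra_simps)
  finally show ?thesis using assms V_of_nat_p by simp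
qed

section \<open>The Frobenius map of the residue field and the group \<open>1 + J\<close>\<close>

lemma of_nat_dvd_J: "p dvd n \<Longrightarrow> of_nat n \<in> J"
  using J_mult' [OF p_in_J] by (elim dvdE) simp

lemma freshman: "(x + y) ^ p - (x ^ p + y ^ p) \<in> J"
proof -
  have p0: "p \<noteq> 0" using prime_p by auto
  have "(x + y) ^ p = (\<Sum>k\<le>p. of_nat (p choose k) * x ^ k * y ^ (p - k))"
    by (rule binomial_ring)
  also have "{..p} = insert 0 (insert p {0<..<p})" using p0 by auto
  also have "(\<Sum>k\<in>\<dots>. of_nat (p choose k) * x ^ k * y ^ (p - k)) =
      y ^ p + x ^ p + (\<Sum>k\<in>{0<..<p}. of_nat (p choose k) * x ^ k * y ^ (p - k))"
    using p0 by (simp add: add.assoc)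
  finally have "(x + y) ^ p - (x ^ p + y ^ p) = (\<Sum>k\<in>{0<..<p}. of_nat (p choose k) * x ^ k * y ^ (p - k))"
    by simp
  also have "\<dots> \<in> J"
    by (rule J_sum) (auto intro!: J_mult' of_nat_dvd_J dvd_choose_prime prime_p)
  finally show ?thesis .
qed

text \<open>The Frobenius map of \<open>F\<close> has trivial kernel. Applying
  \<open>freshman\<close> to \<open>x - y\<close> and \<open>y\<close> avoids the sign of
  \<open>(- y) ^ p\<close>.\<close>

lemma power_p_inj: "x ^ p - y ^ p \<in> J \<Longrightarrow> x - y \<in> J"
proof -
  assume "x ^ p - y ^ p \<in> J"
  moreover have "x ^ p - ((x - y) ^ p + y ^ p) \<in> J" using freshman [of "x - y" y] by simp
  ultimately have "(x ^ p - y ^ p) - (x ^ p - ((x - y) ^ p + y ^ p)) \<in> J" by (rule J_diff)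
  then have "(x - y) ^ p \<in> J" by simp
  then show ?thesis using J_power_iff [of p] prime_p prime_gt_0_nat by blast
qed

lemma power_p_power_inj: "x ^ (p ^ m) - y ^ (p ^ m) \<in> J \<Longrightarrow> x - y \<in> J"
proof (induction m arbitrary: x y)
  case (Suc m)
  then have "x ^ p - y ^ p \<in> J" by (simp add: power_mult)
  then show ?case by (rule power_p_inj)
qed simp

text \<open>By finiteness two iterated Frobenius powers coincide, and injectivity cancels the
  smaller one. This later supplies exponents prime to \<open>p\<close> and, for
  \<open>p = 2\<close>, square roots modulo \<open>J\<close>.\<close>

lemma power_p_periodic: "\<exists>m\<ge>1. x ^ (p ^ m) - x \<in> J"
proof -
  have "finite (range (\<lambda>i::nat. x ^ (p ^ i)))"
    by (rule finite_in_ring)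
  then have "\<not> inj (\<lambda>i::nat. x ^ (p ^ i))"
    using finite_imageD infinite_UNIV_nat by blast
  then obtain i j :: nat where ij: "i < j" "x ^ (p ^ i) = x ^ (p ^ j)"
    by (metis (mono_tags, lifting) injI linorder_neqE_nat)
  have "p ^ j = p ^ (j - i) * p ^ i" using ij by (simp flip: power_add)
  then have "(x ^ (p ^ (j - i))) ^ (p ^ i) - x ^ (p ^ i) \<in> J"
    using ij(2) zero_in_J by (simp flip: power_mult)
  then show ?thesis using power_p_power_inj ij(1) by (intro exI [of _ "j - i"]) auto
qed

text \<open>Factor \<open>r\<close> out of the binomial expansion: in what remains, the coefficients
  with \<open>k < p\<close> are divisible by \<open>p\<close>, and the term \<open>k = p\<close>
  keeps the factor \<open>r ^ (p - 1)\<close> with \<open>p - 1 \<ge> 1\<close>.\<close>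

lemma J_one_plus_power: "r \<in> J \<Longrightarrow> \<exists>s\<in>J. (1 + r) ^ p = 1 + r * s"
proof -
  assume r: "r \<in> J"
  have p2: "2 \<le> p" using prime_p prime_ge_2_nat by blast
  have "(1 + r) ^ p = (r + 1) ^ p" by (simp add: add.commute)
  also have "\<dots> = (\<Sum>k\<le>p. of_nat (p choose k) * r ^ k)"
    by (simp add: binomial_ring)
  also have "{..p} = insert 0 {0<..p}" by auto
  also have "(\<Sum>k\<in>\<dots>. of_nat (p choose k) * r ^ k) = 1 + (\<Sum>k\<in>{0<..p}. of_nat (p choose k) * r ^ k)"
    by simp
  also have "(\<Sum>k\<in>{0<..p}. of_nat (p choose k) * r ^ k) =
      r * (\<Sum>k\<in>{0<..p}. of_nat (p choose k) * r ^ (k - 1))"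
    unfolding sum_distrib_left
  proof (rule sum.cong)
    fix k assume "k \<in> {0<..p}"
    then have "r ^ k = r * r ^ (k - 1)" by (metis greaterThanAtMost_iff power_minus_mult mult.commute)
    then show "of_nat (p choose k) * r ^ k = r * (of_nat (p choose k) * r ^ (k - 1))"
      by (simp add: algebra_simps)
  qed simp
  finally have *: "(1 + r) ^ p = 1 + r * (\<Sum>k\<in>{0<..p}. of_nat (p choose k) * r ^ (k - 1))" .
  have "(\<Sum>k\<in>{0<..p}. of_nat (p choose k) * r ^ (k - 1)) \<in> J"
  proof (rule J_sum)
    fix k assume k: "k \<in> {0<..p}"
    show "of_nat (p choose k) * r ^ (k - 1) \<in> J"
    proof (cases "k = p")
      case True
      then show ?thesis using r p2 by (simp add: J_power_iff)
    next
      case False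
      then show ?thesis using k by (intro J_mult' of_nat_dvd_J dvd_choose_prime prime_p) auto
    qed
  qed
  with * show ?thesis by blast
qed

text \<open>Nakayama's lemma for a principal ideal: \<open>1 - s\<close> is a unit.\<close>

lemma J_absorb: "s \<in> J \<Longrightarrow> x = x * s \<Longrightarrow> x = 0"
proof -
  assume s: "s \<in> J" and x: "x = x * s"
  have "1 - s \<notin> J" using s J_cong [of "1" "1 - s"] one_notin_J by simp
  then obtain t where "(1 - s) * t = 1" by (metis unitE)
  then have "x = x * (1 - s) * t" by (simp add: mult.assoc)
  also have "x * (1 - s) = 0" using x by (simp add: algebra_simps)
  finally show ?thesis by simp
qed

text \<open>Each step multiplies the deviation \<open>x m = (1 + r) ^ (p ^ m) - 1\<close> by an
  element of \<open>J\<close>. Finiteness makes two deviations equal, so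
  \<open>x i = x i * s\<close> with \<open>s \<in> J\<close>, and \<open>J_absorb\<close>
  applies.\<close>

lemma one_plus_J_order: "r \<in> J \<Longrightarrow> \<exists>m. (1 + r) ^ (p ^ m) = 1"
proof -
  assume r: "r \<in> J"
  define x where "x = (\<lambda>m::nat. (1 + r) ^ (p ^ m) - 1)"
  have step: "\<exists>s\<in>J. x (Suc m) = x m * s" if xm: "x m \<in> J" for m
  proof -
    obtain s where "s \<in> J" "(1 + x m) ^ p = 1 + x m * s" using J_one_plus_power [OF xm] by blast
    moreover have "(1 + x m) ^ p = 1 + x (Suc m)" by (simp add: x_def flip: power_mult) (simp add: mult.commute)
    ultimately show ?thesis by auto
  qed
  have inJ: "x m \<in> J" for m
  proof (induction m)
    case 0 then show ?case using r by (simp add: x_def)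
  next
    case (Suc m) then show ?case using step J_mult' by metis
  qed
  have chain: "\<exists>s\<in>J. x (i + Suc n) = x i * s" for i n
  proof (induction n)
    case 0 then show ?case using step inJ by simp
  next
    case (Suc n)
    then obtain s where "s \<in> J" "x (i + Suc n) = x i * s" by blast
    moreover obtain t where "t \<in> J" "x (Suc (i + Suc n)) = x (i + Suc n) * t" using step inJ by blast
    ultimately show ?case by (intro bexI [of _ "s * t"]) (auto simp: mult.assoc J_mult)
  qed
  have "finite (range x)" by (rule finite_in_ring)
  then have "\<not> inj x" using finite_imageD infinite_UNIV_nat by blast
  then obtain i j where ij: "i < j" "x i = x j" by (metis (mono_tags, lifting) injI linorder_neqE_nat)
  then obtain n where "j = i + Suc n" using less_imp_Suc_add by auto
  then obtain s where "s \<in> J" "x i = x i * s" using chain ij(2) by metis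
  then have "x i = 0" by (rule J_absorb)
  then show ?thesis by (auto simp: x_def)
qed

lemma one_plus_J_exponent: "\<exists>m. \<forall>r\<in>J. (1 + r) ^ (p ^ m) = 1"
proof -
  obtain f where f: "\<And>r. r \<in> J \<Longrightarrow> (1 + r) ^ (p ^ f r) = 1" using one_plus_J_order by metis
  have finJ: "finite J" by (rule finite_in_ring)
  have "(1 + r) ^ (p ^ Max (f ` J)) = 1" if r: "r \<in> J" for r
  proof -
    have "f r \<le> Max (f ` J)" using finJ r by simp
    then have "p ^ Max (f ` J) = p ^ f r * p ^ (Max (f ` J) - f r)" by (simp flip: power_add)
    then show ?thesis using f [OF r] by (simp add: power_mult)
  qed
  then show ?thesis by blast
qed

section \<open>Orders of units and a generator modulo \<open>J\<close>\<close>

lemma unit_order: "u \<notin> J \<Longrightarrow> \<exists>n\<ge>1. u ^ n = 1"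
proof -
  assume u: "u \<notin> J"
  have "finite (range (\<lambda>i::nat. u ^ i))" by (rule finite_in_ring)
  then have "\<not> inj (\<lambda>i::nat. u ^ i)" using finite_imageD infinite_UNIV_nat by blast
  then obtain i j :: nat where ij: "i < j" "u ^ i = u ^ j" by (metis (mono_tags, lifting) injI linorder_neqE_nat)
  obtain v where v: "u ^ i * v = 1" using u J_power_iff [of i u] one_notin_J by (metis unitE gr0I power_0)
  have "u ^ (j - i) = u ^ (j - i) * (u ^ i * v)" by (simp add: v)
  also have "\<dots> = u ^ j * v" using ij(1) by (simp add: mult.assoc [symmetric] flip: power_add)
  also have "\<dots> = 1" using ij(2) v by simp
  finally show ?thesis using ij(1) by (intro exI [of _ "j - i"]) auto
qed

text \<open>The type is recast as a ring record so that cyclicity of the multiplicative group of a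
  finite field applies to the quotient by \<open>J\<close>; a generator there is lifted to a
  representative \<open>g\<close>.\<close>

lemma residue_field_generator: "\<exists>g. g \<notin> J \<and> (\<forall>u. u \<notin> J \<longrightarrow> (\<exists>i::nat. u - g ^ i \<in> J))"
proof -
  define R where "R = \<lparr>carrier = UNIV :: 'a set, mult = (*), one = (1 :: 'a), zero = (0 :: 'a), add = (+)\<rparr>"
  have R_simps: "carrier R = UNIV" "mult R = (*)" "one R = 1" "zero R = 0" "add R = (+)"
    by (simp_all add: R_def)
  have cring: "cring R"
  proof (rule cringI)
    show "abelian_group R"
      by (rule abelian_groupI) (auto simp: R_simps algebra_simps intro: exI [of _ "- _"])
    show "Group.comm_monoid R"
      by (rule comm_monoidI) (auto simp: R_simps algebra_simps)
  qed (auto simp: R_simps algebra_simps)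
  interpret R: cring R by (rule cring)
  have a_inv: "\<ominus>\<^bsub>R\<^esub> x = - x" for x
    by (rule R.minus_equality) (auto simp: R_simps)
  have inv: "inv\<^bsub>\<lparr>carrier = UNIV, mult = (+), one = 0 :: 'a\<rparr>\<^esub> x = - x" for x
    using a_inv [of x] by (simp add: a_inv_def R_simps)
  have id: "ideal J R"
  proof (rule idealI)
    show "subgroup J (add_monoid R)"
      by (rule subgroup.intro) (auto simp: R_simps J_add zero_in_J inv J_neg)
  qed (auto simp: R_simps J_mult J_mult' R.ring_axioms)
  have max: "maximalideal J R"
  proof (rule maximalidealI [OF id])
    show "carrier R \<noteq> J" using one_notin_J by (auto simp: R_simps)
    fix I assume I: "ideal I R" "J \<subseteq> I" "I \<subseteq> carrier R"
    show "I = J \<or> I = carrier R"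
    proof (rule disjCI)
      assume "I \<noteq> carrier R"
      then have "1 \<notin> I" using ideal.one_imp_carrier [OF I(1)] by (auto simp: R_simps)
      have "x \<in> J" if "x \<in> I" for x
        using that \<open>1 \<notin> I\<close> ideal.I_r_closed [OF I(1), of x] unitE [of x] by (metis R_simps(1,2) UNIV_I)
      then show "I = J" using I(2) by blast
    qed
  qed
  have car: "carrier (R Quot J) = range ((+>\<^bsub>R\<^esub>) J)"
    by (auto simp: FactRing_def A_RCOSETS_def RCOSETS_def a_r_coset_def R_simps)
  have zero: "\<zero>\<^bsub>R Quot J\<^esub> = J" by (simp add: FactRing_def)
  interpret Q: field "R Quot J" by (rule maximalideal.quotient_is_field [OF max cring])
  interpret h: ring_hom_ring R "R Quot J" "(+>\<^bsub>R\<^esub>) J" by (rule ideal.rcos_ring_hom_ring [OF id])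
  have coset: "J +>\<^bsub>R\<^esub> x = (\<lambda>r. r + x) ` J" for x by (auto simp: a_r_coset_def r_coset_def R_simps)
  have mem: "x \<in> J +>\<^bsub>R\<^esub> x" for x using imageI [OF zero_in_J, of "\<lambda>r. r + x"] by (simp add: coset)
  have eqD: "x - y \<in> J" if "J +>\<^bsub>R\<^esub> x = J +>\<^bsub>R\<^esub> y" for x y
    using mem [of x] that by (auto simp: coset)
  have unit: "J +>\<^bsub>R\<^esub> x \<noteq> J \<longleftrightarrow> x \<notin> J" for x
  proof
    show "x \<notin> J" if ne: "J +>\<^bsub>R\<^esub> x \<noteq> J"
    proof
      assume x: "x \<in> J"
      have "y \<in> (\<lambda>r. r + x) ` J" if "y \<in> J" for y
        using J_diff [OF that x] by (intro image_eqI [of _ _ "y - x"]) auto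
      then have "J +>\<^bsub>R\<^esub> x = J" using x J_add by (auto simp: coset)
      then show False using ne by simp
    qed
    show "J +>\<^bsub>R\<^esub> x \<noteq> J" if "x \<notin> J" using mem [of x] that by auto
  qed
  have "finite (carrier (R Quot J))" unfolding car by (rule finite_imageI [OF finite_ring])
  then obtain a where a: "a \<in> carrier (mult_of (R Quot J))"
      "carrier (mult_of (R Quot J)) = {a [^]\<^bsub>R Quot J\<^esub> i | i::nat. i \<in> UNIV}"
    using Q.finite_field_mult_group_has_gen by blast
  from a(1) obtain g where g: "a = J +>\<^bsub>R\<^esub> g" "a \<noteq> J" unfolding carrier_mult_of car zero by blast
  have gJ: "g \<notin> J" using g unit by auto
  have pow: "a [^]\<^bsub>R Quot J\<^esub> i = J +>\<^bsub>R\<^esub> (g ^ i)" for i :: nat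
  proof (induction i)
    case 0 show ?case using h.hom_one by (simp add: R_simps)
  next
    case (Suc i)
    then show ?case using h.hom_mult [of "g ^ i" g] by (simp add: R_simps g mult.commute)
  qed
  have "\<exists>i::nat. u - g ^ i \<in> J" if u: "u \<notin> J" for u
  proof -
    have "J +>\<^bsub>R\<^esub> u \<in> carrier (mult_of (R Quot J))"
      unfolding carrier_mult_of car zero using u unit by blast
    then obtain i :: nat where "J +>\<^bsub>R\<^esub> u = J +>\<^bsub>R\<^esub> (g ^ i)" unfolding a(2) pow by blast
    then show ?thesis using eqD by blast
  qed
  with gJ show ?thesis by blast
qed

text \<open>Frobenius periodicity yields the exponent \<open>p ^ m - 1\<close>, which is prime to
  \<open>p\<close>.\<close>

lemma order_mod_J:
  assumes "u \<notin> J"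
  obtains n where "\<not> p dvd n" "u ^ n - 1 \<in> J"
proof -
  obtain m where m: "1 \<le> m" "u ^ (p ^ m) - u \<in> J" using power_p_periodic by blast
  have pm: "0 < p ^ m" using prime_p prime_gt_0_nat by simp
  have "u ^ (p ^ m) = u * u ^ (p ^ m - 1)"
    using pm by (metis mult.commute power_minus_mult)
  then have "u ^ (p ^ m - 1) - 1 \<in> J"
    using m(2) assms J_cancel [of u "u ^ (p ^ m - 1)" 1] by simp
  moreover have "\<not> p dvd p ^ m - 1"
  proof
    assume "p dvd p ^ m - 1"
    moreover have "p dvd p ^ m" using m(1) by (simp add: dvd_power)
    ultimately have "p dvd p ^ m - (p ^ m - 1)" by (rule dvd_diff_nat [rotated])
    then have "p dvd 1" using pm by simp
    then show False using prime_p by simp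
  qed
  ultimately show ?thesis using that by blast
qed

end

section \<open>Rigidity of maps with restricted difference quotients\<close>

text \<open>The sum is, up to sign, the \<open>n\<close>-th finite difference of
  \<open>\<phi>\<close> at \<open>0\<close>; Pascal's rule splits off one more difference.\<close>

lemma alternating_binomial_Suc:
  fixes \<phi> :: "nat \<Rightarrow> 'b::comm_ring_1"
  shows "(\<Sum>i\<le>Suc n. (-1) ^ i * of_nat (Suc n choose i) * \<phi> i) =
    (\<Sum>i\<le>n. (-1) ^ i * of_nat (n choose i) * \<phi> i) - (\<Sum>i\<le>n. (-1) ^ i * of_nat (n choose i) * \<phi> (Suc i))"
proof -
  have "(\<Sum>i\<le>n. (-1) ^ i * of_nat (n choose i) * \<phi> i) = (\<Sum>i\<le>Suc n. (-1) ^ i * of_nat (n choose i) * \<phi> i)"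
    by (simp add: binomial_eq_0)
  also have "\<dots> = \<phi> 0 + (\<Sum>i\<le>n. (-1) ^ Suc i * of_nat (n choose Suc i) * \<phi> (Suc i))"
    by (subst sum.atMost_Suc_shift) simp
  finally show ?thesis
    by (subst sum.atMost_Suc_shift) (simp add: algebra_simps sum.distrib sum_subtractf sum_negf)
qed

text \<open>\<open>A_pure\<close> tests principal ideals, which suffices because every nonzero ideal
  contains a nonzero principal one.\<close>

locale pure_subgroup = finite_local J p for J :: "'a::comm_ring_1 set" and p +
  fixes A :: "'a set"
  assumes A_V: "a \<in> A \<Longrightarrow> a \<in> V"
    and A_zero: "0 \<in> A"
    and A_add: "a \<in> A \<Longrightarrow> b \<in> A \<Longrightarrow> a + b \<in> A"
    and A_neg: "a \<in> A \<Longrightarrow> - a \<in> A"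
    and A_pure: "(\<And>r. r * v \<in> A) \<Longrightarrow> v = 0"
begin

lemma A_diff: "a \<in> A \<Longrightarrow> b \<in> A \<Longrightarrow> a - b \<in> A"
  using A_add [OF _ A_neg] by fastforce

text \<open>Since \<open>J\<close> annihilates \<open>A\<close>, the condition for \<open>x - y \<in> J\<close> says that \<open>h\<close> is constant on the cosets of \<open>J\<close>;
  these are thus the maps \<open>F \<rightarrow> V\<close> with \<open>h 0 = 0\<close> all of whose difference quotients lie in \<open>A\<close>.\<close>

definition slope_maps :: "('a \<Rightarrow> 'a) set" where
  "slope_maps = {h. h 0 = 0 \<and> (\<forall>x y. \<exists>a\<in>A. h x - h y = (x - y) * a)}"

lemma slope_mapsE:
  assumes "h \<in> slope_maps"
  obtains a where "a \<in> A" "h x - h y = (x - y) * a"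
  using assms by (auto simp: slope_maps_def)

lemma slope_maps_value:
  assumes "h \<in> slope_maps"
  obtains a where "a \<in> A" "h x = x * a"
  using assms slope_mapsE [OF assms, of x 0] by (auto simp: slope_maps_def)

lemma slope_maps_V: "h \<in> slope_maps \<Longrightarrow> h x \<in> V"
  by (metis A_V V_mult slope_maps_value)

lemma slope_maps_cong:
  assumes "h \<in> slope_maps" "x - y \<in> J"
  shows "h x = h y"
proof -
  obtain a where "a \<in> A" "h x - h y = (x - y) * a" using slope_mapsE [OF assms(1)] .
  then show ?thesis using V_kill(2) [OF A_V assms(2)] by simp
qed

section \<open>Iterated differences and the reduction to additive maps\<close>

definition linear :: "('a \<Rightarrow> 'a) \<Rightarrow> bool" where
  "linear h \<longleftrightarrow> (\<forall>x. h x = x * h 1)"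

text \<open>The finite difference in direction \<open>b\<close>, corrected by the constant
  \<open>h b\<close> so that \<open>0\<close> goes to \<open>0\<close> and \<open>slope_maps\<close>
  is preserved. It vanishes for all \<open>b\<close> exactly when \<open>h\<close> is
  additive.\<close>

definition shift_diff :: "'a \<Rightarrow> ('a \<Rightarrow> 'a) \<Rightarrow> 'a \<Rightarrow> 'a" where
  "shift_diff b h = (\<lambda>x. h (x + b) - h x - h b)"

lemma shift_diff_slope_maps:
  assumes "h \<in> slope_maps"
  shows "shift_diff b h \<in> slope_maps"
proof -
  have "\<exists>a\<in>A. shift_diff b h x - shift_diff b h y = (x - y) * a" for x y
  proof -
    obtain a where a: "a \<in> A" "h (x + b) - h (y + b) = (x + b - (y + b)) * a" using slope_mapsE [OF assms] .
    obtain a' where a': "a' \<in> A" "h x - h y = (x - y) * a'" using slope_mapsE [OF assms] .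
    have "shift_diff b h x - shift_diff b h y = (h (x + b) - h (y + b)) - (h x - h y)"
      by (simp add: shift_diff_def)
    also have "\<dots> = (x - y) * (a - a')" using a(2) a'(2) by (simp add: right_diff_distrib)
    finally show ?thesis using A_diff a(1) a'(1) by blast
  qed
  then show ?thesis using assms by (auto simp: slope_maps_def shift_diff_def)
qed

lemma funpow_shift_diff_slope_maps: "h \<in> slope_maps \<Longrightarrow> (shift_diff b ^^ n) h \<in> slope_maps"
  by (induction n) (auto intro: shift_diff_slope_maps)

lemma shift_diff_commute: "shift_diff b (shift_diff c h) = shift_diff c (shift_diff b h)"
  by (rule ext) (simp add: shift_diff_def algebra_simps)

lemma linear_shift_diff:
  assumes "linear h"
  shows "linear (shift_diff b h)"
proof -
  have "h (x + b) - h x - h b = 0" for x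
  proof -
    have lin: "h y = y * h 1" for y using assms unfolding linear_def by blast
    show ?thesis unfolding lin [of "x + b"] lin [of x] lin [of b] by (simp add: algebra_simps)
  qed
  then show ?thesis by (simp add: linear_def shift_diff_def)
qed

lemma linear_funpow_shift_diff: "linear h \<Longrightarrow> linear ((shift_diff b ^^ n) h)"
  by (induction n) (auto intro: linear_shift_diff)

lemma funpow_shift_diff_commute:
  "shift_diff c ((shift_diff b ^^ n) h) = (shift_diff b ^^ n) (shift_diff c h)"
  by (induction n) (simp_all add: shift_diff_commute [of c])

text \<open>\<open>E n x\<close> is, up to sign, the ordinary \<open>n\<close>-th difference of
  \<open>h\<close>, and \<open>E n 0\<close> collects the corrections by constants.\<close>

lemma funpow_shift_diff_expand:
  fixes h b
  defines "E \<equiv> \<lambda>n x. \<Sum>i\<le>n. (-1) ^ i * of_nat (n choose i) * h (x + of_nat i * b)"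
  assumes "h 0 = 0"
  shows "(shift_diff b ^^ n) h x = (-1) ^ n * (E n x - E n 0)"
proof (induction n arbitrary: x)
  case 0
  then show ?case using assms(2) by (simp add: E_def)
next
  case (Suc n)
  have E: "E (Suc n) x = E n x - E n (x + b)" for x
    unfolding E_def by (subst alternating_binomial_Suc) (simp add: algebra_simps)
  show ?case
    by (simp add: shift_diff_def [of b "(shift_diff b ^^ n) h"] Suc E algebra_simps)
qed

text \<open>The inner binomial coefficients lie in \<open>J\<close> and kill \<open>V\<close>, and
  the values of \<open>h\<close> at \<open>x\<close> and \<open>x + of_nat p * b\<close> agree. The
  two end terms cancel for odd \<open>p\<close>; for \<open>p = 2\<close> they add up to
  \<open>2 * h x = 0\<close>.\<close>

lemma funpow_p_shift_diff:
  assumes "h \<in> slope_maps"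
  shows "(shift_diff b ^^ p) h = (\<lambda>x. 0)"
proof
  fix x
  have h0: "h 0 = 0" using assms by (simp add: slope_maps_def)
  have p0: "0 < p" using prime_p prime_gt_0_nat by simp
  have zero: "(\<Sum>i\<le>p. (-1) ^ i * of_nat (p choose i) * h (x + of_nat i * b)) = 0" for x
  proof -
    have "{..p} = insert 0 (insert p {0<..<p})" using p0 by auto
    then have "(\<Sum>i\<le>p. (-1) ^ i * of_nat (p choose i) * h (x + of_nat i * b)) =
        h x + (-1) ^ p * h (x + of_nat p * b) +
        (\<Sum>i\<in>{0<..<p}. (-1) ^ i * of_nat (p choose i) * h (x + of_nat i * b))"
      using p0 by (simp add: add.assoc)
    also have "h (x + of_nat p * b) = h x"
      using J_mult' [OF p_in_J, of b] by (intro slope_maps_cong [OF assms]) simp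
    also have "(\<Sum>i\<in>{0<..<p}. (-1) ^ i * of_nat (p choose i) * h (x + of_nat i * b)) = 0"
    proof (rule sum.neutral, rule ballI)
      fix i assume "i \<in> {0<..<p}"
      then have "of_nat (p choose i) \<in> J"
        by (intro of_nat_dvd_J dvd_choose_prime prime_p) auto
      then show "(-1) ^ i * of_nat (p choose i) * h (x + of_nat i * b) = 0"
        using V_kill(2) [OF slope_maps_V [OF assms]] by (simp add: mult.assoc)
    qed
    also have "h x + (-1) ^ p * h x + 0 = 0"
    proof (cases "p = 2")
      case True
      then show ?thesis using V_of_nat_p [OF slope_maps_V [OF assms], of x] by simp
    next
      case False
      then have "odd p" using prime_p prime_odd_nat prime_ge_2_nat by (metis le_neq_implies_less)
      then show ?thesis by simp
    qed
    finally show ?thesis .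
  qed
  then show "(shift_diff b ^^ p) h x = 0"
    unfolding funpow_shift_diff_expand [of h, OF h0] zero by simp
qed

text \<open>Directions are treated one at a time. In direction \<open>b\<close> the last nonlinear
  iterated difference before the first linear one is taken; it exists since the \<open>p\<close>-th
  one is zero. Differences commute and preserve linearity, so directions already treated stay
  linear.\<close>

lemma nonlinear_with_linear_differences:
  assumes "finite S" "h \<in> slope_maps" "\<not> linear h"
  shows "\<exists>g\<in>slope_maps. \<not> linear g \<and> (\<forall>b\<in>S. linear (shift_diff b g))"
  using assms(1)
proof (induction S)
  case empty
  then show ?case using assms by blast
next
  case (insert b S)
  then obtain g where g: "g \<in> slope_maps" "\<not> linear g" "\<forall>b\<in>S. linear (shift_diff b g)" by blast
  have "linear ((shift_diff b ^^ p) g)"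
    unfolding funpow_p_shift_diff [OF g(1)] by (simp add: linear_def)
  then obtain k where k: "\<not> linear ((shift_diff b ^^ k) g)" "linear ((shift_diff b ^^ Suc k) g)"
    using ex_least_nat_less [of "\<lambda>n. linear ((shift_diff b ^^ n) g)" p] g(2) by auto
  have "linear (shift_diff c ((shift_diff b ^^ k) g))" if "c \<in> insert b S" for c
  proof (cases "c = b")
    case True
    then show ?thesis using k(2) by simp
  next
    case False
    then show ?thesis
      unfolding funpow_shift_diff_commute using that g(3) by (intro linear_funpow_shift_diff) auto
  qed
  then show ?case using k(1) funpow_shift_diff_slope_maps [OF g(1)] by blast
qed

text \<open>For a unit \<open>b\<close> the difference is \<open>x \<mapsto> x * v\<close>. At
  \<open>x = b * r\<close> it is also \<open>b\<close> times a difference of two elements of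
  \<open>A\<close>, so cancelling \<open>b\<close> gives \<open>r * v \<in> A\<close> for all
  \<open>r\<close>, and purity yields \<open>v = 0\<close>.\<close>

lemma additive_if_linear_differences:
  assumes g: "g \<in> slope_maps" and lin: "\<And>b. linear (shift_diff b g)"
  shows "g (x + b) = g x + g b"
proof (cases "b \<in> J")
  case True
  have "g (x + b) = g x" "g b = g 0" using True slope_maps_cong [OF g] by simp_all
  then show ?thesis using g by (simp add: slope_maps_def)
next
  case False
  then obtain b' where b': "b * b' = 1" using unitE by metis
  define v where "v = shift_diff b g 1"
  have v: "shift_diff b g x = x * v" for x using lin [of b] unfolding v_def linear_def by blast
  have "r * v \<in> A" for r
  proof -
    obtain a where a: "a \<in> A" "g (b * r + b) - g (b * r) = (b * r + b - b * r) * a" using slope_mapsE [OF g] .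
    obtain a0 where a0: "a0 \<in> A" "g b = b * a0" using slope_maps_value [OF g] .
    have "b * (r * v) = shift_diff b g (b * r)" using v by (simp add: mult.assoc)
    also have "\<dots> = b * (a - a0)" using a(2) a0(2) by (simp add: shift_diff_def algebra_simps)
    finally have "b' * (b * (r * v)) = b' * (b * (a - a0))" by simp
    then have "r * v = a - a0" using b' by (metis mult.assoc mult.commute mult_1_left)
    then show ?thesis using A_diff a(1) a0(1) by simp
  qed
  then have "v = 0" by (rule A_pure)
  then have "shift_diff b g x = 0" using v by simp
  then show ?thesis by (simp add: shift_diff_def algebra_simps)
qed

section \<open>Linearity of the additive maps with quotients in \<open>A\<close>\<close>

definition additive_slope_maps :: "('a \<Rightarrow> 'a) set" where
  "additive_slope_maps = {h. (\<forall>x y. h (x + y) = h x + h y) \<and> (\<forall>x. \<exists>a\<in>A. h x = x * a)}"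

text \<open>For a generator \<open>u\<close> of the multiplicative group of \<open>F\<close> let \<open>T h x = u\<^sup>-\<^sup>1 * h (u * x) - h x\<close>. Comparing the
  difference quotients of \<open>h\<close> at \<open>x\<close>, \<open>u * x\<close> and \<open>(1 - u) * x\<close> shows that even \<open>(1 - u)\<^sup>-\<^sup>1 * T h\<close> has its
  quotients in \<open>A\<close>. As \<open>u\<close> has order prime to \<open>p\<close>, \<open>T\<close> is bijective on its image, so this can be iterated:
  the multipliers \<open>r\<close> that keep the image of \<open>T\<close> inside the class form all of \<open>R\<close>, and purity gives \<open>T h = 0\<close>.\<close>

lemma additive_linear:
  assumes "h \<in> additive_slope_maps"
  shows "h x = x * h 1"
proof -
  let ?H = additive_slope_maps
  have add: "k (x + y) = k x + k y" if "k \<in> ?H" for k x y using that by (simp add: additive_slope_maps_def)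
  have val: "\<exists>a\<in>A. k x = x * a" if "k \<in> ?H" for k x using that by (simp add: additive_slope_maps_def)
  have kV: "k x \<in> V" if "k \<in> ?H" for k x using val [OF that, of x] A_V V_mult by metis
  have zero: "k 0 = 0" if "k \<in> ?H" for k using add [OF that, of 0 0] by simp
  have kJ: "k x = 0" if "k \<in> ?H" "x \<in> J" for k x
    using val [OF that(1), of x] V_kill(2) [OF A_V that(2)] by metis
  have kdiff: "k (x - y) = k x - k y" if "k \<in> ?H" for k x y
    using add [OF that, of "x - y" y] by (simp add: algebra_simps)
  have kcong: "k x = k y" if "k \<in> ?H" "x - y \<in> J" for k x y
    using kJ [OF that] kdiff [OF that(1)] by simp
  have Hdiff: "(\<lambda>x. k x - l x) \<in> ?H" if "k \<in> ?H" "l \<in> ?H" for k l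
  proof -
    have "\<exists>a\<in>A. k x - l x = x * a" for x
      using val [OF that(1), of x] val [OF that(2), of x] by (metis A_diff right_diff_distrib)
    then show ?thesis using that by (simp add: additive_slope_maps_def algebra_simps)
  qed
  obtain u where u: "u \<notin> J" "\<And>s. s \<notin> J \<Longrightarrow> \<exists>i::nat. s - u ^ i \<in> J" using residue_field_generator by blast
  obtain u' where u': "u * u' = 1" "u' \<notin> J" using u(1) unitE by metis
  have u'u: "u' * (u * x) = x" for x using u' by (metis mult.assoc mult.commute mult_1_left)
  define T where "T = (\<lambda>k x. u' * k (u * x) - k x)"
  have T_app: "T k x = u' * k (u * x) - k x" for k x by (simp add: T_def)
  have T_H: "T k \<in> ?H" if "k \<in> ?H" for k
  proof -
    have "(\<lambda>x. u' * k (u * x)) \<in> ?H"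
    proof -
      have "\<exists>a\<in>A. u' * k (u * x) = x * a" for x
        using val [OF that, of "u * x"] u'u by (metis mult.assoc)
      then show ?thesis using add [OF that] by (simp add: additive_slope_maps_def distrib_left)
    qed
    then show ?thesis unfolding T_def by (rule Hdiff) (rule that)
  qed
  \<comment> \<open>\<open>b = T k\<close> satisfies \<open>u' * b (u * x) = b x\<close>, so
    \<open>i\<close> twists of \<open>k\<close> add \<open>of_nat i * b\<close>. After
    \<open>n\<close> twists, with \<open>u ^ n\<close> congruent to \<open>1\<close> and
    \<open>n\<close> prime to \<open>p\<close>, \<open>k\<close> returns to itself, whence
    \<open>b = 0\<close>.\<close>
  have T_inj: "T k x = 0" if k: "k \<in> ?H" and TT0: "\<And>x. T (T k) x = 0" for k x
  proof -
    define b where "b = T k"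
    have b: "u' * b (u * x) = b x" for x using TT0 [of x] unfolding b_def T_app [of "T k"] by simp
    have bpow: "u' ^ i * b (u ^ i * x) = b x" for i x
    proof (induction i arbitrary: x)
      case (Suc i)
      have "u' ^ Suc i * b (u ^ Suc i * x) = u' ^ i * (u' * b (u * (u ^ i * x)))" by (simp add: mult_ac)
      then show ?case using b Suc by simp
    qed simp
    have kpow: "u' ^ i * k (u ^ i * x) = k x + of_nat i * b x" for i x
    proof (induction i arbitrary: x)
      case (Suc i)
      have "u' ^ Suc i * k (u ^ Suc i * x) = u' ^ i * (u' * k (u * (u ^ i * x)))" by (simp add: mult_ac)
      also have "\<dots> = u' ^ i * (k (u ^ i * x) + b (u ^ i * x))" by (simp add: b_def T_def)
      also have "\<dots> = k x + of_nat (Suc i) * b x"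
        using Suc bpow [of i x] by (simp add: distrib_left) (simp add: algebra_simps)
      finally show ?case .
    qed simp
    obtain n where n: "\<not> p dvd n" "u ^ n - 1 \<in> J" using order_mod_J [OF u(1)] .
    have "u' ^ n * u ^ n = 1" using u'(1) by (metis mult.commute power_mult_distrib power_one)
    then have "u' ^ n - 1 = - (u' ^ n * (u ^ n - 1))" by (simp add: right_diff_distrib)
    then have n': "u' ^ n - 1 \<in> J" using n(2) J_neg J_mult by simp
    have "k (u ^ n * x) = k x" using J_mult' [OF n(2), of x] by (intro kcong [OF k]) (simp add: algebra_simps)
    then have "of_nat n * b x = 0" using kpow [of n x] V_cong [OF kV [OF k, of x] n'] by simp
    then show ?thesis using V_of_nat_cancel [of "b x" n] kV [OF T_H [OF k], of x] n(1) by (simp add: b_def)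
  qed
  have T_diff: "T (\<lambda>x. k x - l x) = (\<lambda>x. T k x - T l x)" for k l
    by (rule ext) (simp add: T_def algebra_simps)
  have "finite (T ` ?H)"
  proof (rule finite_subset)
    show "finite {f. \<forall>x. (x \<in> UNIV \<longrightarrow> f x \<in> (UNIV :: 'a set)) \<and> (x \<notin> (UNIV :: 'a set) \<longrightarrow> f x = 0)}"
      by (rule finite_set_of_finite_funs) (rule finite_ring)+
  qed simp
  moreover have "T ` (T ` ?H) \<subseteq> T ` ?H" using T_H by blast
  moreover have "inj_on T (T ` ?H)"
  proof (rule inj_onI)
    fix k l assume kl: "k \<in> T ` ?H" "l \<in> T ` ?H" "T k = T l"
    then obtain k' l' where k': "k = T k'" "k' \<in> ?H" "l = T l'" "l' \<in> ?H" by blast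
    have "T (\<lambda>x. k' x - l' x) x = 0" for x
    proof (rule T_inj)
      show "(\<lambda>x. k' x - l' x) \<in> ?H" using k' Hdiff by blast
      show "T (T (\<lambda>x. k' x - l' x)) x = 0" for x using kl(3) k' by (simp add: T_diff)
    qed
    then show "k = l" using k' by (auto simp: T_diff)
  qed
  ultimately have TT: "T ` (T ` ?H) = T ` ?H" by (rule endo_inj_surj)
  define C where "C = {r. \<forall>k\<in>?H. (\<lambda>x. r * T k x) \<in> ?H}"
  have C1: "1 \<in> C" using T_H by (simp add: C_def)
  have Cdiff: "r - s \<in> C" if "r \<in> C" "s \<in> C" for r s
    using that Hdiff by (auto simp: C_def left_diff_distrib)
  have T_fix: "T k x = 0" if k: "k \<in> ?H" and x: "x \<notin> J" for k x
  proof (cases "1 - u \<in> J")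
    \<comment> \<open>Here the generator \<open>u\<close> is \<open>1\<close> modulo
      \<open>J\<close>, so \<open>F\<close> has two elements and \<open>T k\<close> vanishes by
      congruence.\<close>
    case True
    then have *: "u - 1 \<in> J" "u' - 1 \<in> J"
      using J_diff_commute J_mult [OF True, of u'] u'(1) by (simp_all add: right_diff_distrib mult.commute)
    have "k (u * x) = k x" using J_mult' [OF *(1), of x] by (intro kcong [OF k]) (simp add: algebra_simps)
    then show ?thesis using V_cong [OF kV [OF k] *(2), of x] by (simp add: T_def)
  next
    case False
    then obtain w where w: "(1 - u) * w = 1" "w \<notin> J" using unitE by metis
    have S: "(\<lambda>x. w * T k x) \<in> ?H" if k: "k \<in> ?H" for k
    proof -
      have "\<exists>a\<in>A. w * T k x = x * a" for x
      proof -
        obtain a b c where abc: "a \<in> A" "b \<in> A" "c \<in> A" "k ((1 - u) * x) = ((1 - u) * x) * a"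
            "k x = x * b" "k (u * x) = (u * x) * c" using val [OF k] by metis
        have "k ((1 - u) * x) = k x - k (u * x)" using kdiff [OF k, of x "u * x"] by (simp add: algebra_simps)
        then have "x * b - u * x * c = (1 - u) * x * a" using abc by simp
        then have xcb: "x * c - x * b = (1 - u) * x * (c - a)" by (simp add: algebra_simps)
        have "T k x = x * c - x * b" using abc(5,6) u'u by (simp add: T_def mult.assoc)
        then have "T k x = (1 - u) * x * (c - a)" unfolding xcb .
        then have "w * T k x = ((1 - u) * w) * (x * (c - a))" by (simp only: mult_ac)
        then show ?thesis using w(1) A_diff abc by auto
      qed
      moreover have "w * T k (x + y) = w * T k x + w * T k y" for x y
        using add [OF T_H [OF k]] by (simp add: distrib_left)
      ultimately show ?thesis by (simp add: additive_slope_maps_def)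
    qed
    \<comment> \<open>Write \<open>T k = T (T l)\<close> by \<open>TT\<close>. Scaling by
      \<open>r\<close> commutes with \<open>T\<close>, so \<open>S\<close> applies to the map
      \<open>r * T l\<close>.\<close>
    have Cw: "w * r \<in> C" if r: "r \<in> C" for r
      unfolding C_def
    proof (intro CollectI ballI)
      fix k assume "k \<in> ?H"
      then have "T k \<in> T ` (T ` ?H)" using TT by blast
      then obtain l where l: "l \<in> ?H" "T k = T (T l)" by blast
      have "(\<lambda>x. r * T l x) \<in> ?H" using r l(1) by (simp add: C_def)
      then have "(\<lambda>x. w * T (\<lambda>x. r * T l x) x) \<in> ?H" by (rule S)
      moreover have "T (\<lambda>x. r * T l x) x = r * T k x" for x
        unfolding l(2) by (simp add: T_app [of "T l"] T_app [of "\<lambda>x. r * T l x"] right_diff_distrib mult_ac)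
      ultimately show "(\<lambda>x. w * r * T k x) \<in> ?H" by (simp add: mult.assoc)
    qed
    \<comment> \<open>As \<open>w\<close> has finite order, its inverse \<open>1 - u\<close> is a
      power of \<open>w\<close> and also maps \<open>C\<close> into itself; differences then give
      multiplication by \<open>u\<close>.\<close>
    obtain N where N: "1 \<le> N" "w ^ N = 1" using unit_order [OF w(2)] by blast
    have Cwi: "w ^ i * r \<in> C" if "r \<in> C" for i r
      using that by (induction i) (auto simp: mult.assoc intro: Cw)
    have "w ^ (N - 1) = (1 - u) * w * w ^ (N - 1)" using w(1) by simp
    also have "\<dots> = (1 - u) * w ^ N" using N(1) by (metis mult.assoc power_minus_mult mult.commute less_eq_Suc_le One_nat_def)
    finally have "w ^ (N - 1) = 1 - u" using N(2) by simp
    then have "(1 - u) * r \<in> C" if "r \<in> C" for r using Cwi [OF that] by metis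
    then have "u * r \<in> C" if "r \<in> C" for r
      using Cdiff [OF that, of "(1 - u) * r"] that by (simp add: algebra_simps)
    then have Cu: "u ^ i \<in> C" for i using C1 by (induction i) auto
    obtain x' where x': "x * x' = 1" using x unitE by metis
    have "r * T k x \<in> A" for r
    proof (cases "r \<in> J")
      case True
      then show ?thesis using V_kill(2) [OF kV [OF T_H [OF k]]] A_zero by simp
    next
      case False
      then have "x * r \<notin> J" using x J_mult_iff by blast
      \<comment> \<open>Choosing the power of \<open>u\<close> for \<open>x * r\<close> rather than
        for \<open>r\<close> lets the factor \<open>x\<close> of the quotient cancel.\<close>
      then obtain i where i: "x * r - u ^ i \<in> J" using u(2) by blast
      obtain a where a: "a \<in> A" "u ^ i * T k x = x * a"
        using Cu [of i] k val [of "\<lambda>x. u ^ i * T k x" x] by (auto simp: C_def)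
      have "x * r * T k x = x * a" using V_cong [OF kV [OF T_H [OF k]] i] a(2) by simp
      then have "x' * (x * (r * T k x)) = x' * (x * a)" by (simp add: mult.assoc)
      then have "r * T k x = a" using x' by (metis mult.assoc mult.commute mult_1_left)
      then show ?thesis using a(1) by simp
    qed
    then show ?thesis by (rule A_pure)
  qed
  have hu: "h (u * x) = u * h x" if "x \<notin> J" for x
  proof -
    have "u' * h (u * x) = h x" using T_fix [OF assms that] by (simp add: T_def)
    then have "u * (u' * h (u * x)) = u * h x" by simp
    then show ?thesis using u'(1) by (simp add: mult.assoc [symmetric])
  qed
  have hpow: "h (u ^ i) = u ^ i * h 1" for i
  proof (induction i)
    case (Suc i)
    have "u ^ i \<notin> J" using u(1) J_power_iff [of i u] one_notin_J by (cases "i = 0") auto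
    then show ?case using hu Suc by (simp add: mult.assoc)
  qed simp
  show ?thesis
  proof (cases "x \<in> J")
    case True
    then show ?thesis using kJ [OF assms] V_kill(2) [OF kV [OF assms]] by simp
  next
    case False
    then obtain i where i: "x - u ^ i \<in> J" using u(2) by blast
    then show ?thesis using kcong [OF assms i] hpow V_cong [OF kV [OF assms] i] by simp
  qed
qed

text \<open>Otherwise some nonlinear \<open>g\<close> has only linear differences; such a
  \<open>g\<close> is additive, hence linear after all.\<close>

theorem slope_maps_linear:
  assumes "h \<in> slope_maps"
  shows "h x = x * h 1"
proof (rule ccontr)
  assume "h x \<noteq> x * h 1"
  then have "\<not> linear h" unfolding linear_def by blast
  then obtain g where g: "g \<in> slope_maps" "\<not> linear g" "\<forall>b\<in>UNIV. linear (shift_diff b g)"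
    using nonlinear_with_linear_differences [OF finite_ring assms] by blast
  then have "g (x + y) = g x + g y" for x y using additive_if_linear_differences by blast
  moreover have "\<exists>a\<in>A. g x = x * a" for x using slope_maps_value [OF g(1)] by metis
  ultimately have "g \<in> additive_slope_maps" by (simp add: additive_slope_maps_def)
  then have "linear g" unfolding linear_def using additive_linear by blast
  then show False using g(2) by simp
qed

end

section \<open>Normalised automorphisms\<close>

text \<open>Taking for \<open>c\<close> the inverse of \<open>r\<close> puts \<open>r * v\<close>
  into \<open>A\<close> for every unit \<open>r\<close>. This is how purity is applied when an
  auxiliary point can be varied freely.\<close>

lemma (in pure_subgroup) zero_if_unit_multiples:
  assumes "\<And>c. c \<notin> J \<Longrightarrow> \<exists>a\<in>A. v = c * a"
  shows "v = 0"
proof (rule A_pure)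
  fix r
  show "r * v \<in> A"
  proof (cases "r \<in> J")
    case True
    have "v \<in> A" using assms [OF one_notin_J] by auto
    then show ?thesis using V_kill(2) [OF A_V True] A_zero by simp
  next
    case False
    then obtain r' where r': "r * r' = 1" "r' \<notin> J" using unitE by metis
    then obtain a where "a \<in> A" "v = r' * a" using assms by blast
    then show ?thesis using r'(1) by (simp add: mult.assoc [symmetric])
  qed
qed

text \<open>A unit \<open>e\<close> would map \<open>V\<close> onto itself, so \<open>V\<close>
  would lie in \<open>d\<close> times \<open>A\<close> and hence in \<open>A\<close>, which purity
  forbids. Congruences modulo \<open>J\<close> are thus read off from the action on
  \<open>V\<close>.\<close>

lemma (in pure_subgroup) J_if_maps_V_into_multiple:
  assumes "d \<notin> J" "v \<in> V" "v \<noteq> 0" and e: "\<And>F. F \<in> V \<Longrightarrow> \<exists>a\<in>A. e * F = d * a"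
  shows "e \<in> J"
proof (rule ccontr)
  assume "e \<notin> J"
  then obtain e' where e': "e * e' = 1" using unitE by metis
  have "r * v \<in> A" for r
  proof -
    obtain a where a: "a \<in> A" "e * (e' * (d * (r * v))) = d * a"
      using e V_mult assms(2) by metis
    then have "d * (r * v) = d * a" using e' by (simp add: mult.assoc [symmetric])
    then show ?thesis using unit_cancel [OF assms(1), of "r * v" a] a(1) by simp
  qed
  then show False using A_pure assms(3) by blast
qed

text \<open>\<open>f_diff\<close> is preservation of the relations, applied with
  \<open>r = x - y\<close>; \<open>K_cong\<close> is the form in which
  \<open>K \<inter> (1 + J) = 1 + A\<close> is used.\<close>

locale normalized_automorphism = pure_subgroup J p A
  for J :: "'a::comm_ring_1 set" and p A +
  fixes K :: "'a set" and f :: "'a \<Rightarrow> 'a"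
  assumes V_nonzero: "\<exists>v\<in>V. v \<noteq> 0"
    and K_unit: "k \<in> K \<Longrightarrow> k \<notin> J"
    and K_mult: "k \<in> K \<Longrightarrow> l \<in> K \<Longrightarrow> k * l \<in> K"
    and K_cong: "k \<in> K \<Longrightarrow> l \<in> K \<Longrightarrow> k - l \<in> J \<Longrightarrow> \<exists>a\<in>A. k = l * (1 + a)"
    and bij_f: "bij f"
    and f_zero: "f 0 = 0"
    and f_one: "f 1 = 1"
    and f_diff: "\<exists>k\<in>K. f x - f y = (x - y) * k"
begin

section \<open>Behaviour of \<open>f\<close> along the cosets of \<open>J\<close>\<close>

lemma f_value: "\<exists>k\<in>K. f x = x * k"
  using f_diff [of x 0] f_zero by simp

lemma f_J_iff: "f x - f y \<in> J \<longleftrightarrow> x - y \<in> J"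
  using f_diff [of x y] K_unit J_mult_iff by metis

lemma f_in_J: "f x \<in> J \<longleftrightarrow> x \<in> J"
  using f_J_iff [of x 0] f_zero by simp

lemma f_surjE:
  obtains x where "f x = y"
  using bij_f by (metis bij_pointE)

lemma f_inj: "f x = f y \<Longrightarrow> x = y"
  using bij_f by (meson bij_is_inj injD)

text \<open>The slopes of \<open>f\<close> from \<open>y\<close> to \<open>x\<close> and from
  \<open>y\<close> to \<open>x + w\<close> agree modulo \<open>J\<close>, hence up to a factor in
  \<open>1 + A\<close>. The left side does not depend on the base point \<open>y\<close>, which can
  therefore be varied.\<close>

lemma f_shift_J:
  assumes xy: "x - y \<notin> J" and k: "k \<in> K" "f x - f y = (x - y) * k" and w: "w \<in> J"
  shows "\<exists>a\<in>A. f (x + w) - f x = k * w + (f x - f y) * a"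
proof -
  obtain k' where k': "k' \<in> K" "f (x + w) - f y = (x + w - y) * k'" using f_diff by blast
  obtain l where l: "f (x + w) - f x = w * l" using f_diff [of "x + w" x] by auto
  have "(x - y) * k' - (x - y) * k = (f (x + w) - f y - w * k') - (f x - f y)"
    unfolding k(2) k'(2) by (simp add: algebra_simps)
  also have "\<dots> = w * l - w * k'" using l by simp
  also have "\<dots> \<in> J" using w by (intro J_diff J_mult')
  finally have "k' - k \<in> J" by (rule J_cancel [OF xy])
  then obtain a where a: "a \<in> A" "k' = k * (1 + a)" using K_cong k(1) k'(1) by blast
  have wa: "w * a = 0" using V_kill(2) [OF A_V w] a(1) by simp
  have "f (x + w) - f x = (x + w - y) * k' - (x - y) * k" using k(2) k'(2) by (simp add: algebra_simps)
  also have "\<dots> = k * w + ((x - y) * k) * a + k * (w * a)" unfolding a(2) by (simp add: algebra_simps)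
  finally show ?thesis using wa a(1) k(2) by auto
qed

text \<open>The terms with \<open>k\<close> cancel, so the defect lies in \<open>f x - f y\<close>
  times \<open>A\<close> for every \<open>y\<close> outside the coset of \<open>x\<close>. As
  \<open>f\<close> is onto, \<open>f x - f y\<close> can be any unit.\<close>

lemma f_shift_J_add:
  assumes "w \<in> J" "w' \<in> J"
  shows "f (x + w + w') - f (x + w) = f (x + w') - f x"
proof -
  define v where "v = (f (x + (w + w')) - f x) - (f (x + w) - f x) - (f (x + w') - f x)"
  have "v = 0"
  proof (rule zero_if_unit_multiples)
    fix c assume c: "c \<notin> J"
    obtain y where y: "f y = f x - c" by (rule f_surjE)
    have xy: "x - y \<notin> J" using f_J_iff [of x y] y c by simp
    obtain k where k: "k \<in> K" "f x - f y = (x - y) * k" using f_diff by blast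
    note shift = f_shift_J [OF xy k]
    obtain a1 where a1: "a1 \<in> A" "f (x + (w + w')) - f x = k * (w + w') + (f x - f y) * a1"
      using shift [OF J_add [OF assms]] by blast
    obtain a2 where a2: "a2 \<in> A" "f (x + w) - f x = k * w + (f x - f y) * a2"
      using shift [OF assms(1)] by blast
    obtain a3 where a3: "a3 \<in> A" "f (x + w') - f x = k * w' + (f x - f y) * a3"
      using shift [OF assms(2)] by blast
    have "v = (f x - f y) * (a1 - a2 - a3)"
      unfolding v_def a1(2) a2(2) a3(2) by (simp add: algebra_simps)
    then show "\<exists>a\<in>A. v = c * a" using y A_diff a1(1) a2(1) a3(1) by auto
  qed
  then show ?thesis by (simp add: v_def algebra_simps)
qed

lemma f_add_J:
  assumes w: "w \<in> J"
  shows "f (x + w) = f x + f w"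
proof -
  \<comment> \<open>The defect is viewed as a function of \<open>X = f x\<close>, because the error
    terms carry the factor \<open>f x - f y\<close>.\<close>
  define G where "G = (\<lambda>X. f (inv_into UNIV f X + w) - f (inv_into UNIV f X) - f w)"
  have G: "G (f x) = f (x + w) - f x - f w" for x
    using inv_f_f [of f x] bij_f by (simp add: G_def bij_is_inj)
  have G_slope: "G \<in> slope_maps"
  proof -
    have "\<exists>a\<in>A. G (f x) - G (f y) = (f x - f y) * a" for x y
    proof (cases "x - y \<in> J")
      case True
      have "f (y + (x - y) + w) - f (y + (x - y)) = f (y + w) - f y"
        using f_shift_J_add [OF True w, of y] .
      then have "G (f x) - G (f y) = (f x - f y) * 0" by (simp add: G)
      then show ?thesis using A_zero by blast
    next
      case False
      then have False': "y - x \<notin> J" using J_diff_commute by blast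
      obtain k where k: "k \<in> K" "f x - f y = (x - y) * k" using f_diff by blast
      \<comment> \<open>The reversed pair has the same slope, so the terms \<open>k * w\<close>
        cancel between the two defects.\<close>
      then have k': "f y - f x = (y - x) * k" by (simp add: algebra_simps)
      obtain a where a: "a \<in> A" "f (x + w) - f x = k * w + (f x - f y) * a"
        using f_shift_J [OF False k w] by blast
      obtain b where b: "b \<in> A" "f (y + w) - f y = k * w + (f y - f x) * b"
        using f_shift_J [OF False' k(1) k' w] by blast
      have "G (f x) - G (f y) = (f x - f y) * (a + b)"
        unfolding G a(2) b(2) by (simp add: algebra_simps)
      then show ?thesis using A_add a(1) b(1) by blast
    qed
    then have "\<exists>a\<in>A. G X - G Y = (X - Y) * a" for X Y by (metis f_surjE)
    moreover have "G 0 = 0" using G [of 0] f_zero by simp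
    ultimately show ?thesis by (simp add: slope_maps_def)
  qed
  define \<alpha> where "\<alpha> = G 1"
  have shift: "f (x + w) - f x - f w = f x * \<alpha>" for x
    using slope_maps_linear [OF G_slope, of "f x"] by (simp add: G \<alpha>_def)
  obtain k1 where k1: "k1 \<in> K" "f (1 + w) - f 1 = w * k1" using f_diff [of "1 + w" 1] by auto
  obtain k0 where k0: "k0 \<in> K" "f w = w * k0" using f_value by blast
  have \<alpha>: "\<alpha> = (k1 - k0) * w"
    using shift [of 1] k1(2) k0(2) f_one by (simp add: algebra_simps)
  txt \<open>If \<open>k1 - k0\<close> were a unit, the map \<open>w \<mapsto> f (x + w) - f x\<close> would kill \<open>w\<close> for a suitable \<open>x\<close>.\<close>
  have "\<alpha> = 0"
  proof (cases "k1 - k0 \<in> J")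
    case True
    then obtain a where a: "a \<in> A" "k1 = k0 * (1 + a)" using K_cong k1(1) k0(1) by blast
    have "\<alpha> = k0 * (a * w)" using \<alpha> a(2) by (simp add: algebra_simps)
    then show ?thesis using V_kill(1) [OF A_V [OF a(1)] w] by simp
  next
    case False
    then obtain c where c: "(k1 - k0) * c = 1" using unitE by metis
    obtain x where x: "f x = - (k0 * c)" by (rule f_surjE)
    have "f (x + w) - f x = w * k0 - k0 * w * ((k1 - k0) * c)"
      using shift [of x] unfolding \<alpha> x k0(2) by (simp add: algebra_simps)
    then have "f (x + w) = f x" using c by (simp add: mult.commute)
    then have "w = 0" using f_inj by fastforce
    then show ?thesis by (simp add: \<alpha>)
  qed
  then show ?thesis using shift [of x] by (simp add: algebra_simps)
qed

text \<open>The increment at \<open>x\<close> is now \<open>f w\<close> itself, so each slope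
  between points of different cosets describes \<open>f\<close> on \<open>J\<close>, up to a
  multiple of \<open>A\<close>.\<close>

lemma f_on_J:
  assumes "x - y \<notin> J" "k \<in> K" "f x - f y = (x - y) * k" "w \<in> J"
  shows "\<exists>a\<in>A. f w = k * w + (f x - f y) * a"
  using f_shift_J [OF assms] f_add_J [OF assms(4), of x] by simp

section \<open>Additivity on the whole ring\<close>

lemma f_V_surj: "F \<in> V \<Longrightarrow> \<exists>w\<in>V. f w = F"
proof -
  assume F: "F \<in> V"
  obtain w where w: "f w = F" by (rule f_surjE)
  obtain k where k: "k \<in> K" "f w = w * k" using f_value by blast
  then obtain k' where "k * k' = 1" using K_unit unitE by metis
  then have "k' * F = w" using w k(2) by (metis mult.assoc mult.commute mult_1_left)
  then show ?thesis using V_mult [OF F] w by blast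
qed

text \<open>Both slopes \<open>k\<close> and \<open>l\<close> describe \<open>f\<close> on
  \<open>V\<close>, so \<open>k' * F\<close> and \<open>l' * F\<close> equal \<open>w\<close> up to
  \<open>d\<close> times \<open>A\<close>. Hence \<open>k' - l'\<close> maps \<open>V\<close> into
  that set and lies in \<open>J\<close>.\<close>

lemma f_add_mod: "f (x + d) - (f x + f d) \<in> J"
proof (cases "d \<in> J")
  case True
  then show ?thesis using f_add_J zero_in_J by simp
next
  case False
  obtain k where k: "k \<in> K" "f (x + d) - f x = (x + d - x) * k" using f_diff by blast
  obtain l where l: "l \<in> K" "f d - f 0 = (d - 0) * l" using f_diff by blast
  obtain k' where k': "k * k' = 1" using k(1) K_unit unitE by metis
  obtain l' where l': "l * l' = 1" using l(1) K_unit unitE by metis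
  obtain v where v: "v \<in> V" "v \<noteq> 0" using V_nonzero by blast
  have "k' - l' \<in> J"
  proof (rule J_if_maps_V_into_multiple [OF False v])
    fix F assume "F \<in> V"
    then obtain w where w: "w \<in> V" "f w = F" using f_V_surj by blast
    obtain a where a: "a \<in> A" "F = k * w + (f (x + d) - f x) * a"
      using f_on_J [OF _ k V_subset_J [OF w(1)]] False w(2) by auto
    obtain b where b: "b \<in> A" "F = l * w + (f d - f 0) * b"
      using f_on_J [OF _ l V_subset_J [OF w(1)]] False w(2) by auto
    have "k' * F = (k * k') * w + (k * k') * d * a" unfolding a(2) k(2) by (simp add: algebra_simps)
    then have "k' * F = w + d * a" using k' by simp
    moreover have "l' * F = (l * l') * w + (l * l') * d * b" unfolding b(2) l(2) by (simp add: algebra_simps)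
    then have "l' * F = w + d * b" using l' by simp
    ultimately have "(k' - l') * F = d * (a - b)" by (simp add: left_diff_distrib right_diff_distrib)
    then show "\<exists>a\<in>A. (k' - l') * F = d * a" using A_diff a(1) b(1) by blast
  qed
  then have "d * k * l * (l' - k') \<in> J" using J_diff_commute J_mult by blast
  also have "d * k * l * (l' - k') = d * k * (l * l') - d * l * (k * k')" by (simp add: algebra_simps)
  also have "\<dots> = f (x + d) - (f x + f d)" using k(2) l(2) k' l' f_zero by (simp add: algebra_simps)
  finally show ?thesis .
qed

text \<open>As a function of \<open>f d\<close>, the defect \<open>h x d\<close> is a slope map,
  because the slopes agree modulo \<open>J\<close> by \<open>f_add_mod\<close>. Rigidity and the
  symmetry of \<open>h\<close> give \<open>h x d = f d * f x * \<beta>\<close>. Since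
  \<open>f x * \<beta> = h x 1\<close> lies in \<open>A\<close> for all \<open>x\<close>, purity
  kills \<open>\<beta>\<close>.\<close>

lemma f_add: "f (x + d) = f x + f d"
proof -
  define h where "h = (\<lambda>x d. f (x + d) - f x - f d)"
  have h_slope: "\<exists>a\<in>A. h x d - h x e = (f d - f e) * a" for x d e
  proof (cases "d - e \<in> J")
    case True
    have "f (x + e + (d - e)) = f (x + e) + f (d - e)" "f (e + (d - e)) = f e + f (d - e)"
      using f_add_J [OF True] by blast+
    then have "h x d - h x e = (f d - f e) * 0" by (simp add: h_def algebra_simps)
    then show ?thesis using A_zero by blast
  next
    case False
    obtain k where k: "k \<in> K" "f (x + d) - f (x + e) = (x + d - (x + e)) * k" using f_diff by blast
    obtain l where l: "l \<in> K" "f d - f e = (d - e) * l" using f_diff by blast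
    have "(d - e) * k - (d - e) * l = (f (x + d) - (f x + f d)) - (f (x + e) - (f x + f e))"
      using k(2) l(2) by (simp add: algebra_simps)
    also have "\<dots> \<in> J" by (intro J_diff f_add_mod)
    finally have "k - l \<in> J" by (rule J_cancel [OF False])
    then obtain a where a: "a \<in> A" "k = l * (1 + a)" using K_cong k(1) l(1) by blast
    have "h x d - h x e = (f (x + d) - f (x + e)) - (f d - f e)" by (simp add: h_def)
    also have "\<dots> = ((d - e) * l) * a" unfolding k(2) l(2) a(2) by (simp add: algebra_simps)
    finally show ?thesis using a(1) l(2) by auto
  qed
  have h0: "h x 0 = 0" for x by (simp add: h_def f_zero)
  have h_lin: "h x d = f d * h x 1" for x d
  proof -
    define H where "H = (\<lambda>X. h x (inv_into UNIV f X))"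
    have H: "H (f d) = h x d" for d using inv_f_f [of f d] bij_f by (simp add: H_def bij_is_inj)
    have "\<exists>a\<in>A. H X - H Y = (X - Y) * a" for X Y using h_slope H by (metis f_surjE)
    moreover have "H 0 = 0" using H [of 0] f_zero h0 by simp
    ultimately have "H \<in> slope_maps" by (simp add: slope_maps_def)
    then have "H (f d) = f d * H (f 1)" using slope_maps_linear f_one by metis
    then show ?thesis by (simp add: H)
  qed
  define \<beta> where "\<beta> = h 1 1"
  have h1: "h x 1 = f x * \<beta>" for x
    using h_lin [of 1 x] by (simp add: h_def \<beta>_def algebra_simps)
  have "\<beta> = 0"
  proof (rule A_pure)
    fix r
    obtain x where x: "f x = r" by (rule f_surjE)
    show "r * \<beta> \<in> A" using h_slope [of x 1 0] h0 h1 x f_zero f_one by auto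
  qed
  then have "h x d = 0" using h_lin [of x d] h1 by simp
  then show ?thesis by (simp add: h_def algebra_simps)
qed

section \<open>Multiplicativity, first modulo \<open>J\<close> and then exactly\<close>

lemma f_minus: "f (x - y) = f x - f y"
  using f_add [of "x - y" y] by (simp add: algebra_simps)

text \<open>The slope \<open>k\<close> between \<open>0\<close> and \<open>e\<close> satisfies
  \<open>k * \<phi> = e'\<close>, and dividing by \<open>f e\<close> turns the error term of
  \<open>f_on_J\<close> into an element of \<open>A\<close>.\<close>

lemma f_inverse_on_J:
  assumes e: "e * e' = 1" and \<phi>: "f e * \<phi> = 1" and w: "w \<in> J"
  shows "\<exists>a\<in>A. \<phi> * f w = e' * w + a"
proof -
  have eJ: "e - 0 \<notin> J" using e unitI by simp
  obtain k where k: "k \<in> K" "f e - f 0 = (e - 0) * k" using f_diff by blast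
  obtain a where a: "a \<in> A" "f w = k * w + (f e - f 0) * a" using f_on_J [OF eJ k w] by blast
  have fe: "f e = e * k" using k(2) f_zero by simp
  have "e' * (f e * \<phi>) = (e * e') * (k * \<phi>)" unfolding fe by (simp only: mult_ac)
  then have "k * \<phi> = e' * (f e * \<phi>)" using e by simp
  then have k\<phi>: "k * \<phi> = e'" using \<phi> by simp
  have "\<phi> * f w = (k * \<phi>) * w + (f e * \<phi>) * a" unfolding a(2) f_zero by (simp add: algebra_simps)
  then show ?thesis using k\<phi> \<phi> a(1) by auto
qed

text \<open>Additivity of \<open>x \<mapsto> 1 / f (1 / x)\<close> modulo \<open>J\<close>, with denominators cleared.\<close>

lemma f_harmonic:
  assumes e: "e1 \<notin> J" "e2 \<notin> J" "e1 + e2 \<notin> J" and t: "t * (e1 + e2) = e1 * e2"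
  shows "f e1 * f e2 - f t * f (e1 + e2) \<in> J"
proof -
  have tJ: "t \<notin> J" using e t J_mult_iff by metis
  obtain e1' e2' where e': "e1 * e1' = 1" "e2 * e2' = 1" using e unitE by metis
  have "t * (e1' + e2') = t * (e1' * (e2 * e2') + e2' * (e1 * e1'))" using e' by simp
  also have "\<dots> = (t * (e1 + e2)) * (e1' * e2')" by (simp add: algebra_simps)
  also have "\<dots> = (e1 * e1') * (e2 * e2')" unfolding t by (simp add: mult_ac)
  finally have t': "t * (e1' + e2') = 1" using e' by simp
  obtain \<phi>1 \<phi>2 \<psi> where \<phi>: "f e1 * \<phi>1 = 1" "f e2 * \<phi>2 = 1" "f t * \<psi> = 1"
    using e tJ f_in_J unitE by metis
  obtain v where v: "v \<in> V" "v \<noteq> 0" using V_nonzero by blast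
  \<comment> \<open>Since \<open>1 / t = 1 / e1 + 1 / e2\<close>, \<open>f_inverse_on_J\<close>
    shows that this combination of the inverses of \<open>f t\<close>, \<open>f e1\<close> and
    \<open>f e2\<close> maps \<open>V\<close> into \<open>A\<close>.\<close>
  have "\<psi> - \<phi>1 - \<phi>2 \<in> J"
  proof (rule J_if_maps_V_into_multiple [OF one_notin_J v])
    fix F assume "F \<in> V"
    then obtain w where w: "w \<in> V" "f w = F" using f_V_surj by blast
    note wJ = V_subset_J [OF w(1)]
    obtain a where a: "a \<in> A" "\<psi> * F = (e1' + e2') * w + a"
      using f_inverse_on_J [OF t' \<phi>(3) wJ] w(2) by blast
    obtain b where b: "b \<in> A" "\<phi>1 * F = e1' * w + b"
      using f_inverse_on_J [OF e'(1) \<phi>(1) wJ] w(2) by blast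
    obtain c where c: "c \<in> A" "\<phi>2 * F = e2' * w + c"
      using f_inverse_on_J [OF e'(2) \<phi>(2) wJ] w(2) by blast
    have "(\<psi> - \<phi>1 - \<phi>2) * F = 1 * (a - b - c)" using a(2) b(2) c(2) by (simp add: algebra_simps)
    then show "\<exists>a\<in>A. (\<psi> - \<phi>1 - \<phi>2) * F = 1 * a" using A_diff a(1) b(1) c(1) by blast
  qed
  then have "(f t * f e1 * f e2) * (\<psi> - \<phi>1 - \<phi>2) \<in> J" by (rule J_mult)
  also have "(f t * f e1 * f e2) * (\<psi> - \<phi>1 - \<phi>2) =
      (f t * \<psi>) * (f e1 * f e2) - f t * f e2 * (f e1 * \<phi>1) - f t * f e1 * (f e2 * \<phi>2)"
    by (simp add: algebra_simps)
  also have "\<dots> = f e1 * f e2 - f t * f (e1 + e2)" using \<phi> f_add by (simp add: algebra_simps)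
  finally show ?thesis .
qed

text \<open>Hua's identity: \<open>f_harmonic\<close> for \<open>a\<close> and \<open>s - a\<close>,
  with \<open>t = a - q\<close>. If \<open>s - a\<close> is not a unit, \<open>q\<close> and
  \<open>s\<close> are both congruent to \<open>a\<close>.\<close>

lemma f_square_quotient:
  assumes a: "a \<notin> J" and s: "s \<notin> J" and q: "q * s = a * a"
  shows "f q * f s - f a * f a \<in> J"
proof (cases "s - a \<in> J")
  case True
  have "s * q - s * a = a * (a - s)" using q by (simp add: algebra_simps)
  then have "s * q - s * a \<in> J" using True J_diff_commute J_mult by metis
  then have "q - a \<in> J" by (rule J_cancel [OF s])
  then show ?thesis using True f_J_iff by (intro J_mult_cong) simp_all
next
  case False
  have "(a - q) * (a + (s - a)) = a * (s - a)" using q by (simp add: algebra_simps)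
  then have "f a * f (s - a) - f (a - q) * f (a + (s - a)) \<in> J"
    using a s False by (intro f_harmonic) simp_all
  then show ?thesis by (simp add: f_minus algebra_simps)
qed

lemma f_square: "f (a * a) - f a * f a \<in> J"
proof (cases "a \<in> J")
  case True
  then show ?thesis using f_in_J J_mult by (intro J_diff) blast+
next
  case False
  then show ?thesis using f_square_quotient [OF False one_notin_J, of "a * a"] f_one by simp
qed

text \<open>In odd residue characteristic squares are polarised. In characteristic 2 every element
  is a square modulo \<open>J\<close>, so \<open>x * y\<close> is replaced by \<open>a * a\<close>
  and \<open>f_square_quotient\<close> is used instead.\<close>

lemma f_mult_mod: "f (x * y) - f x * f y \<in> J"
proof (cases "2 \<in> J")
  case False
  have "2 * f (x * y) - 2 * (f x * f y) =
      f ((x + y) * (x + y)) - f (x + y) * f (x + y) - (f (x * x) - f x * f x) - (f (y * y) - f y * f y)"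
  proof -
    have "(x + y) * (x + y) = x * x + x * y + (x * y + y * y)" by (simp add: algebra_simps)
    then have "f ((x + y) * (x + y)) = f (x * x) + f (x * y) + (f (x * y) + f (y * y))"
      by (simp only: f_add)
    then show ?thesis by (simp add: f_add algebra_simps)
  qed
  also have "\<dots> \<in> J" by (intro J_diff f_square)
  finally show ?thesis by (rule J_cancel [OF False])
next
  case True
  show ?thesis
  proof (cases "x \<in> J \<or> y \<in> J")
    case True
    then show ?thesis using f_in_J J_mult_iff by (intro J_diff) blast+
  next
    case False
    then have xy: "x * y \<notin> J" "x \<notin> J" "y \<notin> J" using J_mult_iff by auto
    have "p = 2"
    proof (rule ccontr)
      assume "p \<noteq> 2"
      then have "odd p" using prime_p prime_odd_nat prime_ge_2_nat by (metis le_neq_implies_less)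
      then obtain j where "p = 2 * j + 1" by (rule oddE)
      then have "(1 :: 'a) = of_nat p - 2 * of_nat j" by simp
      also have "\<dots> \<in> J" using True by (intro J_diff p_in_J J_mult')
      finally show False using one_notin_J by simp
    qed
    then obtain m where m: "1 \<le> m" "(x * y) ^ (2 ^ m) - x * y \<in> J" using power_p_periodic by blast
    \<comment> \<open>By Frobenius periodicity this is a square root of \<open>x * y\<close> modulo
      \<open>J\<close>.\<close>
    define a where "a = (x * y) ^ (2 ^ (m - 1))"
    have "(2::nat) ^ m = 2 ^ (m - 1) + 2 ^ (m - 1)" using m(1) by (cases m) auto
    then have "a * a = (x * y) ^ (2 ^ m)" by (simp add: a_def power_add)
    then have aa: "a * a - x * y \<in> J" using m(2) by simp
    then have aJ: "a \<notin> J" using J_cong xy(1) J_mult by blast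
    obtain y' where y': "y * y' = 1" using xy(3) unitE by metis
    \<comment> \<open>\<open>f_square_quotient\<close> needs an exact equation; \<open>q\<close>
      solves it and is congruent to \<open>x\<close>.\<close>
    define q where "q = a * a * y'"
    have "q * y = (y * y') * (a * a)" unfolding q_def by (simp only: mult_ac)
    then have q: "q * y = a * a" using y' by simp
    then have "y * q - y * x \<in> J" using aa by (simp add: mult.commute)
    then have "q - x \<in> J" by (rule J_cancel [OF xy(3)])
    then have "(f q - f x) * f y \<in> J" using f_J_iff J_mult' by blast
    from J_diff [OF this f_square_quotient [OF aJ xy(3) q]]
    have "f a * f a - f x * f y \<in> J" by (simp add: left_diff_distrib)
    from J_add [OF f_square [of a] this]
    have "f (a * a) - f x * f y \<in> J" by simp
    moreover have "f (a * a) - f (x * y) \<in> J" using aa f_J_iff by blast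
    ultimately have "(f (a * a) - f x * f y) - (f (a * a) - f (x * y)) \<in> J" by (rule J_diff)
    then show ?thesis by (simp add: algebra_simps)
  qed
qed

text \<open>The defect \<open>h\<close> is additive. At a unit \<open>d\<close> it lies in
  \<open>f x * f d\<close> times \<open>A\<close> by \<open>f_mult_mod\<close>; at
  \<open>r \<in> J\<close> it is \<open>h d - h (d - r)\<close>, and as \<open>f d\<close> may be
  any unit, purity kills it. Divided by \<open>f x\<close>, it is a slope map in \<open>f d\<close>
  that vanishes at \<open>1\<close>.\<close>

lemma f_mult_unit:
  assumes x: "x \<notin> J"
  shows "f (x * d) = f x * f d"
proof -
  define h where "h = (\<lambda>d. f (x * d) - f x * f d)"
  have h_diff: "h (d - e) = h d - h e" for d e
    by (simp add: h_def f_minus right_diff_distrib)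
  have h_unit: "\<exists>a\<in>A. h d = f x * f d * a" if d: "d \<notin> J" for d
  proof -
    obtain k where k: "k \<in> K" "f (x * d) = x * d * k" using f_value by blast
    obtain l where l: "l \<in> K" "f x = x * l" using f_value by blast
    obtain l' where l': "l' \<in> K" "f d = d * l'" using f_value by blast
    have "f (x * d) - f x * f d \<in> J" by (rule f_mult_mod)
    then have "x * d * k - x * d * (l * l') \<in> J" unfolding k(2) l(2) l'(2) by (simp add: mult_ac)
    then have "k - l * l' \<in> J" using J_cancel x d J_mult_iff by blast
    then obtain a where a: "a \<in> A" "k = l * l' * (1 + a)" using K_cong k(1) K_mult l(1) l'(1) by blast
    have "h d = f x * f d * a" unfolding h_def k(2) l(2) l'(2) a(2) by (simp add: algebra_simps)
    then show ?thesis using a(1) by blast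
  qed
  have h_J: "h r = 0" if r: "r \<in> J" for r
  proof (rule zero_if_unit_multiples)
    fix c assume c: "c \<notin> J"
    obtain x' where x': "f x * x' = 1" "x' \<notin> J" using x f_in_J unitE by metis
    obtain d where d: "f d = x' * c" by (rule f_surjE)
    then have dJ: "d \<notin> J" using f_in_J [of d] x'(2) c J_mult_iff by simp
    then have drJ: "d - r \<notin> J" using r J_cong [of d "d - r"] by simp
    obtain a where a: "a \<in> A" "h d = f x * f d * a" using h_unit [OF dJ] by blast
    obtain b where b: "b \<in> A" "h (d - r) = f x * f (d - r) * b" using h_unit [OF drJ] by blast
    have "f r * b = 0" using V_kill(2) [OF A_V [OF b(1)]] r f_in_J by simp
    then have "f (d - r) * b = f d * b"
      by (simp add: f_minus left_diff_distrib)
    then have "f x * f (d - r) * b = f x * f d * b"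
      by (simp add: mult.assoc)
    then have "h r = f x * f d * (a - b)" using h_diff [of d r] a(2) b(2) by (simp add: algebra_simps)
    also have "f x * f d = c" using x'(1) d by (simp add: mult.assoc [symmetric])
    finally show "\<exists>a\<in>A. h r = c * a" using A_diff a(1) b(1) by blast
  qed
  obtain x' where x': "f x * x' = 1" using x f_in_J unitE by metis
  define H where "H = (\<lambda>X. x' * h (inv_into UNIV f X))"
  have H: "H (f d) = x' * h d" for d using inv_f_f [of f d] bij_f by (simp add: H_def bij_is_inj)
  have "\<exists>a\<in>A. H (f d) - H (f e) = (f d - f e) * a" for d e
  proof (cases "d - e \<in> J")
    case True
    then have "H (f d) - H (f e) = (f d - f e) * 0" using h_J h_diff [of d e] by (simp add: H)
    then show ?thesis using A_zero by blast
  next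
    case False
    then obtain a where a: "a \<in> A" "h (d - e) = f x * f (d - e) * a" using h_unit by blast
    have "H (f d) - H (f e) = x' * h (d - e)" by (simp add: H h_diff right_diff_distrib)
    also have "\<dots> = (f x * x') * (f (d - e) * a)" unfolding a(2) by (simp add: mult_ac)
    finally show ?thesis using x' a(1) f_minus by auto
  qed
  then have "\<exists>a\<in>A. H X - H Y = (X - Y) * a" for X Y by (metis f_surjE)
  moreover have "H 0 = 0" using H [of 0] f_zero by (simp add: h_def)
  ultimately have "H \<in> slope_maps" by (simp add: slope_maps_def)
  then have "H (f d) = f d * H (f 1)" using slope_maps_linear f_one by metis
  also have "H (f 1) = 0" unfolding H by (simp add: h_def f_one)
  finally have "f x * (x' * h d) = 0" by (simp add: H)
  then have "h d = 0" using x' by (simp add: mult.assoc [symmetric])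
  then show ?thesis by (simp add: h_def)
qed

text \<open>For \<open>x \<in> J\<close> the element \<open>1 + x\<close> is a unit, and additivity
  removes the \<open>1\<close>.\<close>

lemma f_mult: "f (x * y) = f x * f y"
proof (cases "x \<in> J")
  case True
  then have "1 + x \<notin> J" using one_notin_J J_cong [of "1 + x" 1] by simp
  then have "f ((1 + x) * y) = f (1 + x) * f y" by (rule f_mult_unit)
  then show ?thesis by (simp add: distrib_right f_add f_one)
qed (rule f_mult_unit)

end

section \<open>The radical and the Teichmueller group\<close>

lemma maximal_ideal_exists:
  assumes fin: "finite (UNIV :: 'a::comm_ring_1 set)" and I: "is_ideal (I :: 'a set)" "1 \<notin> I"
  obtains M where "maximal_ideal M" "I \<subseteq> M"
proof -
  let ?P = "\<lambda>M. is_ideal M \<and> 1 \<notin> M \<and> I \<subseteq> M"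
  have "finite (Collect ?P)" by (rule finite_subset [OF _ finite_Pow_iff [THEN iffD2, OF fin]]) auto
  moreover have "I \<in> Collect ?P" using I by simp
  ultimately have "\<exists>M\<in>Collect ?P. I \<subseteq> M \<and> (\<forall>N\<in>Collect ?P. M \<subseteq> N \<longrightarrow> M = N)"
    by (rule finite_has_maximal2)
  then obtain M where "M \<in> Collect ?P" "\<forall>N\<in>Collect ?P. M \<subseteq> N \<longrightarrow> M = N" by blast
  then have M: "?P M" "\<And>N. ?P N \<Longrightarrow> M \<subseteq> N \<Longrightarrow> N = M" by auto
  have "1 \<notin> N" if "is_ideal N" "N \<noteq> UNIV" for N :: "'a set"
    using that unfolding is_ideal_def by (metis UNIV_eq_I mult.right_neutral)
  then have "maximal_ideal M" using M unfolding maximal_ideal_def by blast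
  then show ?thesis using that M(1) by blast
qed

lemma principal_is_ideal: "is_ideal (range (\<lambda>r. r * (x :: 'a::comm_ring_1)))"
proof -
  have "0 \<in> range (\<lambda>r. r * x)" by (rule range_eqI [of _ _ 0]) simp
  moreover have "r * x + s * x \<in> range (\<lambda>r. r * x)" for r s
    by (rule range_eqI [of _ _ "r + s"]) (simp add: distrib_right)
  moreover have "s * (r * x) \<in> range (\<lambda>r. r * x)" for r s
    by (rule range_eqI [of _ _ "s * r"]) (simp add: mult.assoc)
  ultimately show ?thesis by (auto simp: is_ideal_def)
qed

text \<open>A nonunit generates a proper ideal, which lies in the only maximal ideal.\<close>

lemma rad_local_ring:
  assumes fin: "finite (UNIV :: 'a::comm_ring_1 set)" and loc: "local_ring TYPE('a)"
  shows "is_ideal (rad :: 'a set)" "(x :: 'a) \<in> rad \<longleftrightarrow> x \<notin> ring_units"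
proof -
  have ex1: "\<exists>!M :: 'a set. maximal_ideal M" using loc by (simp add: local_ring_def)
  then have max: "maximal_ideal (rad :: 'a set)" unfolding rad_def by (rule theI')
  then show ideal: "is_ideal (rad :: 'a set)" by (simp add: maximal_ideal_def)
  show "x \<in> rad \<longleftrightarrow> x \<notin> ring_units"
  proof
    assume x: "x \<in> rad"
    show "x \<notin> ring_units"
    proof
      assume "x \<in> ring_units"
      then obtain y where "x * y = 1" by (auto simp: ring_units_def)
      then have "r = (r * y) * x" for r by (simp add: mult.assoc mult.commute [of y])
      moreover have "(r * y) * x \<in> rad" for r using x ideal unfolding is_ideal_def by blast
      ultimately have "r \<in> rad" for r :: 'a by metis
      then show False using max by (auto simp: maximal_ideal_def)
    qed
  next
    assume "x \<notin> ring_units"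
    then have "1 \<notin> range (\<lambda>r. r * x)" by (auto simp: ring_units_def mult.commute)
    then obtain M where "maximal_ideal M" "range (\<lambda>r. r * x) \<subseteq> M"
      using maximal_ideal_exists [OF fin principal_is_ideal] by metis
    moreover have "x \<in> range (\<lambda>r. r * x)" by (rule range_eqI [of _ _ 1]) simp
    ultimately show "x \<in> rad" using ex1 max by blast
  qed
qed

text \<open>The residue characteristic is the least positive \<open>n\<close> whose image lies in
  \<open>rad\<close>. It is prime because a product of units is a unit, so one factor of
  \<open>n\<close> already lies in \<open>rad\<close>.\<close>

lemma finite_local_rad:
  assumes fin: "finite (UNIV :: 'a::comm_ring_1 set)" and loc: "local_ring TYPE('a)"
  shows "\<exists>p. finite_local (rad :: 'a set) p"
proof -
  note ideal = rad_local_ring(1) [OF fin loc] and rad_iff = rad_local_ring(2) [OF fin loc]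
  let ?P = "\<lambda>n. 0 < n \<and> (of_nat n :: 'a) \<in> rad"
  have zero: "(0 :: 'a) \<in> rad" using ideal by (simp add: is_ideal_def)
  have one: "(1 :: 'a) \<notin> rad" unfolding rad_iff by (auto simp: ring_units_def)
  have "\<not> inj (of_nat :: nat \<Rightarrow> 'a)"
    using finite_imageD [of "of_nat :: nat \<Rightarrow> 'a" UNIV] finite_subset [OF subset_UNIV fin] infinite_UNIV_nat
    by metis
  then obtain i j :: nat where "i < j" "(of_nat i :: 'a) = of_nat j"
    by (metis (mono_tags, lifting) injI linorder_neqE_nat)
  then have ji: "?P (j - i)" using zero by (simp add: of_nat_diff)
  define n where "n = (LEAST n. ?P n)"
  have n: "?P n" "\<And>m. ?P m \<Longrightarrow> n \<le> m"
    unfolding n_def by (rule LeastI [of ?P, OF ji]) (rule Least_le)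
  have "prime n"
  proof (rule prime_nat_iff [THEN iffD2], intro conjI allI impI)
    have "n \<noteq> 1" using n(1) one by (metis of_nat_1)
    then show "1 < n" using n(1) by simp
    fix m assume "m dvd n"
    then obtain k where k: "n = m * k" by (rule dvdE)
    have pos: "0 < m" "0 < k" using n(1) k by auto
    have "(of_nat m :: 'a) \<in> rad \<or> (of_nat k :: 'a) \<in> rad"
    proof (rule ccontr)
      assume "\<not> ?thesis"
      then obtain y z where "(of_nat m :: 'a) * y = 1" "(of_nat k :: 'a) * z = 1"
        unfolding rad_iff by (auto simp: ring_units_def)
      then have "((of_nat m :: 'a) * y) * (of_nat k * z) = 1" by simp
      then have "(of_nat n :: 'a) * (y * z) = 1" unfolding k of_nat_mult by (simp only: mult_ac)
      then show False using n(1) unfolding rad_iff by (auto simp: ring_units_def)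
    qed
    then show "m = 1 \<or> m = n"
    proof
      assume "(of_nat m :: 'a) \<in> rad"
      then have "n \<le> m" using n(2) pos by blast
      then show ?thesis using k pos by (metis dvd_imp_le dvd_triv_left le_antisym mult_pos_pos)
    next
      assume "(of_nat k :: 'a) \<in> rad"
      then have "m * k \<le> k" using n(2) pos k by blast
      then show ?thesis using pos by simp
    qed
  qed
  then have "finite_local (rad :: 'a set) n"
    using fin rad_iff ideal n(1) by unfold_locales (auto simp: is_ideal_def)
  then show ?thesis by blast
qed

text \<open>Multiplication by \<open>t\<close> permutes \<open>T\<close>, and the product of all
  elements of \<open>T\<close> is a unit that can be cancelled.\<close>

lemma unit_subgroup_power_card:
  assumes fin: "finite (T :: 'a::comm_ring_1 set)" and T: "is_unit_subgroup T" and t: "t \<in> T"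
  shows "t ^ card T = 1"
proof -
  obtain s where s: "s \<in> T" "t * s = 1" using T t by (auto simp: is_unit_subgroup_def)
  have inj: "inj_on ((*) t) T"
    by (rule inj_on_inverseI [where g = "(*) s"]) (metis s(2) mult.assoc mult.commute mult_1_left)
  moreover have "(*) t ` T = T"
  proof (rule endo_inj_surj [OF fin _ inj])
    show "(*) t ` T \<subseteq> T" using T t by (auto simp: is_unit_subgroup_def)
  qed
  ultimately have "\<Prod>T = (\<Prod>x\<in>T. t * x)" by (metis prod.reindex_cong)
  also have "\<dots> = t ^ card T * \<Prod>T" by (simp add: prod.distrib)
  finally have *: "\<Prod>T = t ^ card T * \<Prod>T" .
  have "\<exists>z. \<Prod>S * z = 1" if "S \<subseteq> T" for S
    using finite_subset [OF that fin] that
  proof (induction S)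
    case (insert x S)
    then obtain z where z: "\<Prod>S * z = 1" by auto
    obtain y where y: "x * y = 1" using T insert.prems by (auto simp: is_unit_subgroup_def)
    have "\<Prod>(insert x S) * (y * z) = (x * y) * (\<Prod>S * z)" using insert.hyps by (simp add: mult_ac)
    then show ?case using y z by auto
  qed (auto intro: exI [of _ 1])
  then obtain z where z: "\<Prod>T * z = 1" by blast
  have "t ^ card T = t ^ card T * \<Prod>T * z" using z by (simp add: mult.assoc)
  also have "\<dots> = 1" using * z by simp
  finally show ?thesis .
qed

section \<open>The Teichmueller group and nonvanishing of \<open>V\<close>\<close>

context finite_local
begin

text \<open>\<open>T\<close> consists of the \<open>N\<close>-th powers of units, where
  \<open>N = p ^ m\<close> kills \<open>1 + J\<close>. The fibres of
  \<open>x \<mapsto> x ^ N\<close> on units are the cosets of \<open>J\<close>, which gives the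
  order of \<open>T\<close> and its trivial intersection with \<open>1 + J\<close>. Uniqueness,
  which the definite description \<open>teich\<close> requires, rests on this order being prime to
  \<open>p\<close>.\<close>

lemma teichmueller_unique:
  "\<exists>T. is_unit_subgroup T \<and> card T = card (UNIV :: 'a set) div card J - 1 \<and> (\<forall>t\<in>T. t - 1 \<in> J \<longrightarrow> t = 1) \<and>
    (\<forall>T'. is_unit_subgroup T' \<longrightarrow> card T' = card T \<longrightarrow> T' = T)"
proof -
  obtain m where m: "\<And>r. r \<in> J \<Longrightarrow> (1 + r) ^ (p ^ m) = 1" using one_plus_J_exponent by blast
  define N where "N = p ^ m"
  have N0: "N \<noteq> 0" using prime_p prime_gt_0_nat by (simp add: N_def)
  define U where "U = - J"
  define T where "T = (\<lambda>x. x ^ N) ` U"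
  have fibre: "y ^ N = x ^ N \<longleftrightarrow> y - x \<in> J" if x: "x \<in> U" for x y
  proof
    assume "y ^ N = x ^ N"
    then show "y - x \<in> J" using power_p_power_inj [of y m x] zero_in_J by (simp add: N_def)
  next
    assume yx: "y - x \<in> J"
    obtain x' where x': "x * x' = 1" using x unitE by (auto simp: U_def)
    have "y = x + (x * x') * (y - x)" unfolding x' by simp
    also have "\<dots> = x * (1 + x' * (y - x))" by (simp add: distrib_left mult.assoc)
    finally have y: "y = x * (1 + x' * (y - x))" .
    have "(1 + x' * (y - x)) ^ N = 1" unfolding N_def using m J_mult yx by blast
    then show "y ^ N = x ^ N" by (subst y) (simp add: power_mult_distrib)
  qed
  have T_triv: "t = 1" if t: "t \<in> T" "t - 1 \<in> J" for t
  proof -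
    obtain x where x: "x \<in> U" "t = x ^ N" using t(1) by (auto simp: T_def)
    then have "x - 1 \<in> J" using t(2) power_p_power_inj [of x m 1] by (simp add: N_def)
    then show ?thesis using fibre [of 1 x] one_notin_J x(2) by (simp add: U_def)
  qed
  have T_sub: "is_unit_subgroup T"
    unfolding is_unit_subgroup_def
  proof (intro conjI ballI)
    show "T \<subseteq> ring_units" using J_power_iff N0 J_iff by (auto simp: T_def U_def)
    show "1 \<in> T" using one_notin_J by (auto simp: T_def U_def intro!: image_eqI [of _ _ 1])
    fix x assume "x \<in> T"
    then obtain a where a: "a \<notin> J" "x = a ^ N" by (auto simp: T_def U_def)
    obtain b where b: "a * b = 1" "b \<notin> J" using a(1) unitE by metis
    show "\<exists>y\<in>T. x * y = 1"
      using a(2) b by (intro bexI [of _ "b ^ N"]) (auto simp: T_def U_def simp flip: power_mult_distrib)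
    fix y assume "y \<in> T"
    then obtain c where c: "c \<notin> J" "y = c ^ N" by (auto simp: T_def U_def)
    have "a * c \<in> U" using a(1) c(1) J_mult_iff by (simp add: U_def)
    then have "(a * c) ^ N \<in> T" unfolding T_def by (rule imageI)
    then show "x * y \<in> T" using a(2) c(2) by (simp add: power_mult_distrib)
  qed
  have finT: "finite T" by (rule finite_in_ring)
  have "card U = (\<Sum>x\<in>U. 1)" by simp
  also have "\<dots> = (\<Sum>t\<in>T. \<Sum>x\<in>{x. x \<in> U \<and> x ^ N = t}. 1)"
    unfolding T_def by (rule sum.image_gen) (rule finite_in_ring)
  also have "\<dots> = (\<Sum>t\<in>T. card J)"
  proof (rule sum.cong)
    fix t assume "t \<in> T"
    then obtain x where x: "x \<in> U" "t = x ^ N" by (auto simp: T_def)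
    have "{y. y \<in> U \<and> y ^ N = t} = (+) x ` J"
    proof (intro equalityI subsetI)
      fix y assume "y \<in> {y. y \<in> U \<and> y ^ N = t}"
      then have "y - x \<in> J" using fibre x by simp
      then show "y \<in> (+) x ` J" by (intro image_eqI [of _ _ "y - x"]) auto
    next
      fix y assume "y \<in> (+) x ` J"
      then have yx: "y - x \<in> J" by auto
      then have "y \<in> U" using J_cong x(1) by (auto simp: U_def)
      then show "y \<in> {y. y \<in> U \<and> y ^ N = t}" using fibre [OF x(1)] yx x(2) by simp
    qed
    then show "(\<Sum>x\<in>{x. x \<in> U \<and> x ^ N = t}. 1) = card J" by (simp add: card_image)
  qed simp
  finally have cardU: "card U = card T * card J" by simp
  have "card (UNIV :: 'a set) = card U + card J"
    using card_Un_disjoint [of U J] finite_in_ring by (simp add: U_def Compl_partition2)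
  then have "card (UNIV :: 'a set) = (card T + 1) * card J" using cardU by simp
  moreover have "0 < card J" using zero_in_J finite_in_ring by (auto simp: card_gt_0_iff)
  ultimately have cardT: "card T = card (UNIV :: 'a set) div card J - 1" by simp
  \<comment> \<open>\<open>T\<close> is generated by \<open>\<tau>\<close>. If
    \<open>card T = p * d\<close>, injectivity of Frobenius modulo \<open>J\<close> gives
    \<open>\<tau> ^ d = 1\<close>, leaving at most \<open>d\<close> elements.\<close>
  have "\<not> p dvd card T"
  proof
    assume dvd: "p dvd card T"
    obtain g where g: "g \<notin> J" "\<And>u. u \<notin> J \<Longrightarrow> \<exists>i::nat. u - g ^ i \<in> J"
      using residue_field_generator by blast
    define \<tau> where "\<tau> = g ^ N"
    have \<tau>T: "\<tau> ^ i \<in> T" for i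
    proof -
      have "g ^ i \<in> U" using g(1) J_power_iff [of i g] one_notin_J by (cases "i = 0") (auto simp: U_def)
      then have "(g ^ i) ^ N \<in> T" unfolding T_def by (rule imageI)
      then show ?thesis by (simp add: \<tau>_def mult.commute flip: power_mult)
    qed
    have \<tau>_gen: "\<exists>i. t = \<tau> ^ i" if t: "t \<in> T" for t
    proof -
      obtain x where x: "x \<in> U" "t = x ^ N" using t by (auto simp: T_def)
      obtain i where i: "x - g ^ i \<in> J" using g(2) x(1) by (auto simp: U_def)
      then have "g ^ i - x \<in> J" using J_diff_commute by blast
      then have "(g ^ i) ^ N = x ^ N" using fibre [OF x(1)] by simp
      then show ?thesis
        using x(2) by (intro exI [of _ i]) (simp add: \<tau>_def mult.commute flip: power_mult)
    qed
    have cT: "0 < card T" using finT \<tau>T by (auto simp: card_gt_0_iff)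
    have \<tau>1: "\<tau> ^ card T = 1" using unit_subgroup_power_card [OF finT T_sub] \<tau>T [of 1] by simp
    obtain d where d: "card T = p * d" using dvd by (rule dvdE)
    have d0: "0 < d" using cT d by (cases d) auto
    have "(\<tau> ^ d) ^ p - 1 ^ p \<in> J" using \<tau>1 d zero_in_J by (simp add: mult.commute flip: power_mult)
    then have "\<tau> ^ d = 1" using power_p_inj T_triv \<tau>T by blast
    then have "\<tau> ^ i = \<tau> ^ (i mod d)" for i
      by (subst mult_div_mod_eq [of d i, symmetric]) (simp only: power_add power_mult power_one mult_1_left)
    then have "T \<subseteq> (\<lambda>i. \<tau> ^ i) ` {..<d}" using \<tau>_gen d0 by (metis image_eqI lessThan_iff mod_less_divisor subsetI)
    then have "card T \<le> card {..<d}" by (rule surj_card_le [OF finite_lessThan])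
    moreover have "1 < p" using prime_p prime_gt_1_nat by blast
    ultimately show False using d d0 by simp
  qed
  then have cop: "coprime N (card T)"
    using prime_p prime_imp_coprime [of p "card T"] by (simp add: N_def)
  \<comment> \<open>By Bezout \<open>N\<close> is invertible modulo the common order, so every
    element of \<open>T'\<close> is an \<open>N\<close>-th power of a unit.\<close>
  have "T' = T" if T': "is_unit_subgroup T'" "card T' = card T" for T'
  proof -
    obtain x y where xy: "N * x = card T * y + 1" using bezout_nat [OF N0, of "card T"] cop by auto
    have "t \<in> T" if t: "t \<in> T'" for t
    proof -
      have tc: "t ^ card T = 1" using unit_subgroup_power_card [OF finite_in_ring T'(1) t] T'(2) by simp
      have "(t ^ x) ^ N = t ^ (card T * y + 1)"
        unfolding xy [symmetric] power_mult [symmetric] by (simp only: mult.commute)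
      also have "\<dots> = t" by (simp add: power_mult tc)
      finally have tN: "(t ^ x) ^ N = t" .
      have "t \<notin> J" using T'(1) t J_iff by (auto simp: is_unit_subgroup_def)
      then have "t ^ x \<in> U" using J_power_iff [of x t] one_notin_J by (cases "x = 0") (auto simp: U_def)
      then have "(t ^ x) ^ N \<in> T" unfolding T_def by (rule imageI)
      then show ?thesis using tN by simp
    qed
    then show ?thesis using T'(2) card_subset_eq [OF finT] by blast
  qed
  then show ?thesis using T_sub cardT T_triv by blast
qed

text \<open>Take \<open>y \<noteq> 0\<close> with a smallest principal ideal. If
  \<open>r * y \<noteq> 0\<close> with \<open>r \<in> J\<close>, then \<open>y\<close> would be a
  multiple of \<open>r * y\<close> by minimality, contradicting \<open>J_absorb\<close>.\<close>

lemma V_nonzero: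
  assumes x: "x \<in> J" "x \<noteq> 0"
  shows "\<exists>v\<in>V. v \<noteq> 0"
proof -
  let ?c = "\<lambda>y :: 'a. card (range (\<lambda>r. r * y))"
  obtain y where y: "y \<noteq> 0" "\<And>z. z \<noteq> 0 \<Longrightarrow> ?c y \<le> ?c z"
    using ex_has_least_nat [of "\<lambda>y. y \<noteq> 0" x ?c, OF x(2)] by blast
  have ry: "r * y = 0" if r: "r \<in> J" for r
  proof (rule ccontr)
    assume "r * y \<noteq> 0"
    then have "card (range (\<lambda>s. s * y)) \<le> card (range (\<lambda>s. s * (r * y)))" by (rule y(2))
    moreover have "range (\<lambda>s. s * (r * y)) \<subseteq> range (\<lambda>s. s * y)"
      by (auto simp: mult.assoc [symmetric])
    ultimately have "range (\<lambda>s. s * (r * y)) = range (\<lambda>s. s * y)"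
      using card_seteq [OF finite_in_ring] by blast
    moreover have "y \<in> range (\<lambda>s. s * y)" by (rule range_eqI [of _ _ 1]) simp
    ultimately obtain s where "y = s * (r * y)" by blast
    then have "y = y * (s * r)" by (simp add: mult_ac)
    then show False using J_absorb [OF J_mult [OF r]] y(1) by blast
  qed
  have "y \<in> J"
  proof (rule ccontr)
    assume "y \<notin> J"
    then show False using ry [OF x(1)] x(2) unit_cancel [of y x 0] by (simp add: mult.commute)
  qed
  then have "y \<in> V" using ry by (simp add: V_def mult.commute)
  then show ?thesis using y(1) by blast
qed

end

lemma teich_congruent_one:
  assumes "finite_local (rad :: 'a::comm_ring_1 set) p" "t \<in> (teich :: 'a set)" "t - 1 \<in> rad"
  shows "t = 1"
proof -
  interpret finite_local "rad :: 'a set" p by (rule assms(1))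
  obtain T :: "'a set" where T: "is_unit_subgroup T" "card T = residue_order TYPE('a) - 1"
      "\<forall>t\<in>T. t - 1 \<in> rad \<longrightarrow> t = 1" "\<forall>T'. is_unit_subgroup T' \<longrightarrow> card T' = card T \<longrightarrow> T' = T"
    using teichmueller_unique unfolding residue_order_def by blast
  have "teich = T" unfolding teich_def
  proof (rule the_equality)
    show "is_unit_subgroup T \<and> card T = residue_order TYPE('a) - 1" using T by blast
    show "T' = T" if "is_unit_subgroup T' \<and> card T' = residue_order TYPE('a) - 1" for T'
      using that T(2,4) by metis
  qed
  then show ?thesis using T(3) assms(2,3) by blast
qed

section \<open>From the cyclotomic scheme to a normalised automorphism\<close>

theorem theorem6p4:
  fixes K :: "'a::comm_ring_1 set"
  assumes "finite (UNIV :: 'a set)"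
    and "local_ring TYPE('a)"
    and "\<exists>x::'a. x \<noteq> 0 \<and> x \<notin> ring_units"
    and "is_unit_subgroup K"
    and "pure K"
    and "K \<subseteq> {t * u | t u. t \<in> teich \<and> u \<in> U0}"
  shows "cyc_normal K"
proof -
  obtain p where fl: "finite_local (rad :: 'a set) p"
    using finite_local_rad [OF assms(1,2)] by blast
  interpret finite_local "rad :: 'a set" p by (rule fl)
  have V_I0: "V = I0" by (simp add: V_def I0_def)
  have K_unit: "k \<notin> rad" if "k \<in> K" for k
    using assms(4) that J_iff by (auto simp: is_unit_subgroup_def)
  have K_one: "1 \<in> K" using assms(4) by (simp add: is_unit_subgroup_def)
  have K_mult: "k * l \<in> K" if "k \<in> K" "l \<in> K" for k l
    using assms(4) that by (simp add: is_unit_subgroup_def)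
  have K_inv: "\<exists>l\<in>K. k * l = 1" if "k \<in> K" for k
    using assms(4) that by (simp add: is_unit_subgroup_def)
  \<comment> \<open>This is where the Teichmueller decomposition of \<open>K\<close> enters:
    \<open>t\<close> is congruent to \<open>k\<close>, hence to \<open>1\<close>, and therefore
    equals \<open>1\<close>.\<close>
  have K_principal: "k - 1 \<in> V" if k: "k \<in> K" "k - 1 \<in> rad" for k
  proof -
    obtain t v where tv: "t \<in> teich" "v \<in> V" "k = t * (1 + v)"
      using assms(6) k(1) unfolding V_I0 U0_def by blast
    have "t - 1 = (k - 1) - t * v" using tv(3) by (simp add: algebra_simps)
    also have "\<dots> \<in> rad" using k(2) J_mult [OF V_subset_J [OF tv(2)]] by (rule J_diff)
    finally have "t = 1" using teich_congruent_one [OF fl] tv(1) by blast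
    then show ?thesis using tv(2,3) by simp
  qed
  define A where "A = {a \<in> V. 1 + a \<in> K}"
  interpret pure_subgroup rad p A
  proof
    show "a \<in> V" if "a \<in> A" for a using that by (simp add: A_def)
    show "0 \<in> A" using K_one zero_in_J by (simp add: A_def V_def)
    show "a + b \<in> A" if "a \<in> A" "b \<in> A" for a b
    proof -
      have "a * b = 0" using that V_kill(1) V_subset_J by (simp add: A_def)
      then have "(1 + a) * (1 + b) = 1 + (a + b)" by (simp add: algebra_simps)
      then show ?thesis using that K_mult V_add by (metis (mono_tags, lifting) A_def mem_Collect_eq)
    qed
    show "- a \<in> A" if a: "a \<in> A" for a
    proof -
      have "a * a = 0" using a V_kill(1) V_subset_J by (simp add: A_def)
      then have e: "(1 + a) * (1 - a) = 1" by (simp add: algebra_simps)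
      obtain l where l: "l \<in> K" "(1 + a) * l = 1" using a K_inv by (auto simp: A_def)
      have "1 + a \<notin> rad" using e by (rule unitI)
      then have "l = 1 - a" using unit_cancel l(2) e by metis
      then show ?thesis using l(1) V_mult [of a "-1"] a by (simp add: A_def)
    qed
    show "v = 0" if v: "\<And>r. r * v \<in> A" for v
    proof -
      have "(\<lambda>x. 1 + x) ` range (\<lambda>r. r * v) \<subseteq> K" using v by (auto simp: A_def)
      then have "range (\<lambda>r. r * v) = {0}"
        using assms(5) principal_is_ideal unfolding pure_def by blast
      then have "1 * v = 0" by blast
      then show ?thesis by simp
    qed
  qed
  have K_cong: "\<exists>a\<in>A. k = l * (1 + a)" if k: "k \<in> K" and l: "l \<in> K" and kl: "k - l \<in> rad" for k l
  proof -
    obtain m where m: "m \<in> K" "l * m = 1" using K_inv l by blast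
    have "k * m - 1 = (k - l) * m" using m(2) by (simp add: left_diff_distrib)
    then have "k * m - 1 \<in> rad" using J_mult' [OF kl] by simp
    then have "k * m - 1 \<in> V" using K_principal K_mult k m(1) by blast
    moreover have "1 + (k * m - 1) \<in> K" using K_mult k m(1) by simp
    ultimately have "k * m - 1 \<in> A" by (simp add: A_def)
    moreover have "k = l * (1 + (k * m - 1))" using m(2) by (simp add: mult.left_commute)
    ultimately show ?thesis by blast
  qed
  have "f \<in> AGammaL1" if f: "f \<in> cyc_aut K" for f
  proof -
    have bij: "bij f" using f by (simp add: cyc_aut_def)
    have slope: "\<exists>k\<in>K. f x - f y = (x - y) * k" for x y
    proof -
      \<comment> \<open>\<open>cyc_rel\<close> subtracts the first component from the second, and
        \<open>1 \<in> K\<close> gives membership.\<close>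
      have "(y, x) \<in> cyc_rel K (x - y)" using K_one by (auto simp: cyc_rel_def intro!: image_eqI [of _ _ 1])
      then have "(f y, f x) \<in> cyc_rel K (x - y)" using f unfolding cyc_aut_def by blast
      then show ?thesis by (auto simp: cyc_rel_def)
    qed
    obtain c where c: "c \<in> K" "f 1 - f 0 = c" using slope [of 1 0] by auto
    obtain m where m: "m \<in> K" "c * m = 1" using K_inv c(1) by blast
    \<comment> \<open>Dividing by \<open>c \<in> K\<close> keeps the slopes in \<open>K\<close> and
      normalises the values at \<open>0\<close> and \<open>1\<close>.\<close>
    define g where "g = (\<lambda>x. (f x - f 0) * m)"
    have fg: "f x = c * g x + f 0" for x
    proof -
      have "c * g x = (c * m) * (f x - f 0)" unfolding g_def by (simp only: mult_ac)
      then show ?thesis using m(2) by simp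
    qed
    have "inj g" using bij_is_inj [OF bij] fg by (metis injD injI)
    then have bij_g: "bij g" using finite_ring finite_UNIV_inj_surj by (metis bij_betw_def)
    interpret normalized_automorphism rad p A K g
    proof
      show "\<exists>v\<in>V. v \<noteq> 0" using assms(3) V_nonzero J_iff by blast
      show "g 1 = 1" using c(2) m(2) by (simp add: g_def)
      show "\<exists>k\<in>K. g x - g y = (x - y) * k" for x y
      proof -
        obtain k where k: "k \<in> K" "f x - f y = (x - y) * k" using slope by blast
        have "g x - g y = (f x - f y) * m" by (simp add: g_def left_diff_distrib)
        then show ?thesis using k K_mult m(1) by (metis mult.assoc)
      qed
    qed (use K_unit K_mult K_cong bij_g in \<open>auto simp: g_def\<close>)
    have "g \<in> ring_aut" using bij_g f_add f_mult f_one by (simp add: ring_aut_def)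
    moreover have "c \<in> ring_units" using c(1) assms(4) by (auto simp: is_unit_subgroup_def)
    ultimately show ?thesis using fg unfolding AGammaL1_def by blast
  qed
  then show ?thesis unfolding cyc_normal_def by blast
qed

end
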